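(* Let $M$ be an even positive integer, $h_0,\dots,h_{M-1}$ the filter coefficients of a wavelet of order $M$, and let $n,d$ be positive integers with $d\le n$ (and $2^{n-d+1}\ge M$). Then the $d$-level quantum wavelet transform $W^{(d)}_n$ on $n$ qubits can be implemented exactly using $\lceil\log_2M\rceil+2$ ancilla qubits and $\mathcal{O}(dn)+\mathcal{O}(dM^{3/2})$ Toffoli gates and elementary one- and two-qubit gates. *)

theory Defs
  imports Complex_Main "Jordan_Normal_Form.Matrix"
begin

text \<open>h :: nat => real gives the filter coefficients h_0,...,h_{M-1} (values at k >= M are
irrelevant). A wavelet of order M: M even, sum h_k = sqrt 2 and the
orthonormality (double-shift) conditions sum_k h_k h_{k+2l} = delta_{l,0}.\<close>

definition wavelet_filter :: "nat \<Rightarrow> (nat \<Rightarrow> real) \<Rightarrow> bool" where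
  "wavelet_filter M h \<longleftrightarrow> M > 0 \<and> even M \<and>
     (\<Sum>k<M. h k) = sqrt 2 \<and>
     (\<forall>l<M. (\<Sum>k<M. if k + 2*l < M then h k * h (k + 2*l) else 0) = (if l = 0 then 1 else 0))"

definition highpass :: "nat \<Rightarrow> (nat \<Rightarrow> real) \<Rightarrow> nat \<Rightarrow> real" where
  "highpass M h k = (-1) ^ k * h (M - 1 - k)"

text \<open>Periodized wavelet kernel on m qubits (size 2^m): row 2r is (h_{j-2r}) and row
2r+1 is (g_{j-2r}), indices taken modulo 2^m.\<close>
definition wavelet_kernel :: "nat \<Rightarrow> (nat \<Rightarrow> real) \<Rightarrow> nat \<Rightarrow> complex mat" where
  "wavelet_kernel M h m = mat (2^m) (2^m) (\<lambda>(i, j).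
     complex_of_real (\<Sum>k<M. if (2 * (i div 2) + k) mod 2^m = j
        then (if even i then h k else highpass M h k) else 0))"

definition perfect_shuffle :: "nat \<Rightarrow> complex mat" where
  "perfect_shuffle m = mat (2^m) (2^m) (\<lambda>(i, j).
     if (even j \<and> i = j div 2) \<or> (odd j \<and> i = 2^(m-1) + j div 2) then 1 else 0)"

definition wavelet_level :: "nat \<Rightarrow> (nat \<Rightarrow> real) \<Rightarrow> nat \<Rightarrow> complex mat" where
  "wavelet_level M h m = perfect_shuffle m * wavelet_kernel M h m"

definition block_ext :: "nat \<Rightarrow> nat \<Rightarrow> complex mat \<Rightarrow> complex mat" where
  "block_ext n m A = mat (2^n) (2^n) (\<lambda>(i, j).
     if i < 2^m \<and> j < 2^m then A $$ (i, j) else if i = j then 1 else 0)"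

fun qwt :: "nat \<Rightarrow> (nat \<Rightarrow> real) \<Rightarrow> nat \<Rightarrow> nat \<Rightarrow> complex mat" where
  "qwt M h n 0 = 1\<^sub>m (2^n)"
| "qwt M h n (Suc d) = block_ext n (n - d) (wavelet_level M h (n - d)) * qwt M h n d"

definition unitary_mat :: "nat \<Rightarrow> complex mat \<Rightarrow> bool" where
  "unitary_mat k U \<longleftrightarrow> U \<in> carrier_mat k k \<and>
     U * mat k k (\<lambda>(i, j). cnj (U $$ (j, i))) = 1\<^sub>m k"

definition qbit :: "nat \<Rightarrow> nat \<Rightarrow> nat" where
  "qbit x q = (x div 2^q) mod 2"

datatype gate =
    Gate1 "complex mat" nat
  | Gate2 "complex mat" nat nat
  | Toffoli nat nat nat

definition flip_bit :: "nat \<Rightarrow> nat \<Rightarrow> nat" where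
  "flip_bit x t = (if qbit x t = 1 then x - 2^t else x + 2^t)"

fun gate_ok :: "nat \<Rightarrow> gate \<Rightarrow> bool" where
  "gate_ok m (Gate1 U q) \<longleftrightarrow> q < m \<and> unitary_mat 2 U"
| "gate_ok m (Gate2 U q1 q2) \<longleftrightarrow> q1 < m \<and> q2 < m \<and> q1 \<noteq> q2 \<and> unitary_mat 4 U"
| "gate_ok m (Toffoli c1 c2 t) \<longleftrightarrow> c1 < m \<and> c2 < m \<and> t < m \<and>
      c1 \<noteq> c2 \<and> c1 \<noteq> t \<and> c2 \<noteq> t"

fun gate_mat :: "nat \<Rightarrow> gate \<Rightarrow> complex mat" where
  "gate_mat m (Gate1 U q) = mat (2^m) (2^m) (\<lambda>(r, c).
      if (\<forall>p<m. p \<noteq> q \<longrightarrow> qbit r p = qbit c p) then U $$ (qbit r q, qbit c q) else 0)"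
| "gate_mat m (Gate2 U q1 q2) = mat (2^m) (2^m) (\<lambda>(r, c).
      if (\<forall>p<m. p \<noteq> q1 \<and> p \<noteq> q2 \<longrightarrow> qbit r p = qbit c p)
      then U $$ (2 * qbit r q1 + qbit r q2, 2 * qbit c q1 + qbit c q2) else 0)"
| "gate_mat m (Toffoli c1 c2 t) = mat (2^m) (2^m) (\<lambda>(r, c).
      if r = (if qbit c c1 = 1 \<and> qbit c c2 = 1 then flip_bit c t else c) then 1 else 0)"

definition circuit_mat :: "nat \<Rightarrow> gate list \<Rightarrow> complex mat" where
  "circuit_mat m gs = foldl (\<lambda>A g. gate_mat m g * A) (1\<^sub>m (2^m)) gs"

text \<open>Circuit on n data qubits (low bits) plus a ancillas (high bits) implements the
2^n x 2^n matrix W exactly with clean ancillas: |x>|0> \<mapsto> (W|x>)|0>.\<close>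
definition implements_exactly :: "nat \<Rightarrow> nat \<Rightarrow> gate list \<Rightarrow> complex mat \<Rightarrow> bool" where
  "implements_exactly n a gs W \<longleftrightarrow>
     (\<forall>g\<in>set gs. gate_ok (n + a) g) \<and>
     (\<forall>r < 2^(n+a). \<forall>c < 2^n.
        circuit_mat (n + a) gs $$ (r, c) = (if r < 2^n then W $$ (r, c) else 0))"

end

theory Submission
  imports Defs
begin

text \<open>Orthonormality lets one peel plane rotations off the filter: the filter bank of length
  \<open>M = 2 K\<close> is a product of \<open>K\<close> rotations separated by unit delays of the odd channel. With the
  delays undone, layer \<open>j\<close> rotates the even coefficient at \<open>r\<close> against the odd one at \<open>r + j\<close>.
  Cut the positions into blocks of length \<open>H = 2 ^ (L - 1) \<ge> K\<close>, where \<open>L\<close> is the logarithm of \<open>M\<close>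
  rounded up. The pairs inside a block, in all layers, may be rotated before all pairs that cross a
  block boundary, and once the odd coefficients are shifted by one block the crossing pairs lie
  inside blocks as well. Hence a level costs \<open>O(M)\<close> operations on \<open>L + O(1)\<close> qubits, of \<open>O(L)\<close> gates
  each, and a constant number of additions to the block number. These have size \<open>O(n)\<close> with a
  bounded number of clean ancillas, because the idle qubits can be used as a dirty summand that is
  first added and then subtracted again. The total \<open>O(d n + d M log M)\<close> is within the bound.\<close>

text \<open>The ancilla budget of \<open>L + 2\<close> qubits shapes the construction. One qubit
  holds the flag that restricts a level to the indices below \<open>2 ^ m\<close>, one a carry or
  comparison bit, and the other \<open>L\<close> suffice for arithmetic on registers of length at
  most \<open>L\<close>, not for storing the carries of a long block number. Everything that is
  repeated \<open>O(M)\<close> times is therefore confined to a block, where wrapping around takes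
  the place of a long carry. Periodization needs no argument of its own: arrays are indexed by all
  integers, and writing a position into a register reduces it modulo the register size. Undoing the
  delays leaves the odd outputs displaced by the number of delays, and the block shift displaces
  them by \<open>H\<close>; one addition at the end settles both. The exponent \<open>3/2\<close> is
  reached because the logarithm of \<open>M\<close> is at most a multiple of its square
  root.\<close>

section \<open>Registers and reversible circuits\<close>

text \<open>Basis states are assignments to infinitely many qubits, so that the number of qubits does
  not have to be carried around. Register values are integers and the first qubit of a register
  is the least significant one; writing a register reduces modulo its size.\<close>

type_synonym asg = "nat \<Rightarrow> bool"

fun reg_val :: "asg \<Rightarrow> nat list \<Rightarrow> int" where
  "reg_val s [] = 0"
| "reg_val s (q # qs) = of_bool (s q) + 2 * reg_val s qs"

fun reg_set :: "asg \<Rightarrow> nat list \<Rightarrow> int \<Rightarrow> asg" where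
  "reg_set s [] v = s"
| "reg_set s (q # qs) v = (reg_set s qs (v div 2))(q := odd v)"

lemma reg_val_bounds: "0 \<le> reg_val s qs" "reg_val s qs < 2 ^ length qs"
  by (induction qs) (auto split: if_splits)

lemma reg_val_cong: "(\<And>q. q \<in> set qs \<Longrightarrow> s q = t q) \<Longrightarrow> reg_val s qs = reg_val t qs"
  by (induction qs) auto

lemma reg_set_other [simp]: "q \<notin> set qs \<Longrightarrow> reg_set s qs v q = s q"
  by (induction qs arbitrary: v) auto

lemma reg_val_upd [simp]: "q \<notin> set qs \<Longrightarrow> reg_val (s(q := b)) qs = reg_val s qs"
  by (rule reg_val_cong) auto

lemma reg_val_reg_set_disjoint [simp]: "set qs \<inter> set ps = {} \<Longrightarrow> reg_val (reg_set s ps v) qs = reg_val s qs"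
  by (intro reg_val_cong reg_set_other) blast

lemma reg_set_upd [simp]: "q \<notin> set qs \<Longrightarrow> reg_set (s(q := b)) qs v = (reg_set s qs v)(q := b)"
  by (induction qs arbitrary: v) (auto simp: fun_upd_twist)

lemma reg_set_reg_set_disjoint:
  "set qs \<inter> set ps = {} \<Longrightarrow> reg_set (reg_set s ps u) qs v = reg_set (reg_set s qs v) ps u"
  by (induction qs arbitrary: v) (auto simp: reg_set_upd)

lemma mod_twice_int: "(v::int) mod (2 * 2 ^ k) = v mod 2 + 2 * (v div 2 mod 2 ^ k)"
  by (simp add: zmod_zmult2_eq)

lemma reg_val_reg_set [simp]: "distinct qs \<Longrightarrow> reg_val (reg_set s qs v) qs = v mod 2 ^ length qs"
  by (induction qs arbitrary: v) (auto simp: mod_twice_int odd_iff_mod_2_eq_one mod_eq_0_iff_dvd)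

lemma reg_set_reg_set [simp]: "distinct qs \<Longrightarrow> reg_set (reg_set s qs u) qs v = reg_set s qs v"
  by (induction qs arbitrary: u v) auto

lemma reg_set_reg_val [simp]: "distinct qs \<Longrightarrow> reg_set s qs (reg_val s qs) = s"
  by (induction qs) auto

lemma reg_set_reg_val_eq: "distinct qs \<Longrightarrow> v = reg_val s qs \<Longrightarrow> reg_set s qs v = s"
  by simp

lemma reg_set_mod [simp]: "reg_set s qs (v mod 2 ^ length qs) = reg_set s qs v"
proof (induction qs arbitrary: v)
  case (Cons q qs)
  have 1: "v mod (2 * 2 ^ length qs) div 2 = v div 2 mod 2 ^ length qs"
    by (simp add: mod_twice_int)
  have 2: "odd (v mod (2 * 2 ^ length qs)) = odd v"
    by (simp add: mod_twice_int)
  show ?case using 1 2 by (simp add: Cons.IH)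
qed simp

lemma reg_set_cong_mod: "u mod 2 ^ length qs = v mod 2 ^ length qs \<Longrightarrow> reg_set s qs u = reg_set s qs v"
  by (metis reg_set_mod)

lemma reg_set_append: "reg_set s (xs @ ys) v = reg_set (reg_set s ys (v div 2 ^ length xs)) xs v"
proof (induction xs arbitrary: v)
  case (Cons q xs)
  have "v div 2 div 2 ^ length xs = v div (2 * 2 ^ length xs)"
    by (simp add: zdiv_zmult2_eq)
  then show ?case by (simp add: Cons.IH)
qed simp

lemma reg_val_append: "reg_val s (xs @ ys) = reg_val s xs + 2 ^ length xs * reg_val s ys"
  by (induction xs) (auto simp: algebra_simps)

lemma reg_set_upt: "reg_set s [a..<b] v q = (if a \<le> q \<and> q < b then bit v (q - a) else s q)"
proof (induction "b - a" arbitrary: a v)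
  case (Suc k)
  then have "[a..<b] = a # [Suc a..<b]" by (simp add: upt_conv_Cons)
  moreover have "bit v (q - a) = bit (v div 2) (q - Suc a)" if "Suc a \<le> q"
  proof -
    have "q - a = Suc (q - Suc a)" using that by simp
    then show ?thesis by (simp only: bit_Suc)
  qed
  moreover have "k = b - Suc a" using Suc(2) by simp
  ultimately show ?case using Suc(1)[of "Suc a" "v div 2"] Suc(2)
    by (auto simp: bit_0)
qed auto

section \<open>Classical reversible gates and addition\<close>

text \<open>NOT, controlled NOT and Toffoli permute the basis states, so circuits made of them can
  be analysed as functions on assignments; only \<open>gate_of\<close> turns them into matrices.
  Each is its own inverse, hence inverse circuits are reversed lists.\<close>

datatype rgate = RX nat | RC nat nat | RT nat nat nat

fun ract1 :: "rgate \<Rightarrow> asg \<Rightarrow> asg" where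
  "ract1 (RX q) s = s(q := \<not> s q)"
| "ract1 (RC a b) s = s(b := (s b \<noteq> s a))"
| "ract1 (RT a b c) s = s(c := (s c \<noteq> (s a \<and> s b)))"

fun rok :: "nat \<Rightarrow> rgate \<Rightarrow> bool" where
  "rok N (RX q) \<longleftrightarrow> q < N"
| "rok N (RC a b) \<longleftrightarrow> a < N \<and> b < N \<and> a \<noteq> b"
| "rok N (RT a b c) \<longleftrightarrow> a < N \<and> b < N \<and> c < N \<and> a \<noteq> b \<and> a \<noteq> c \<and> b \<noteq> c"

definition roks :: "nat \<Rightarrow> rgate list \<Rightarrow> bool" where
  "roks N gs \<longleftrightarrow> (\<forall>g\<in>set gs. rok N g)"

lemma roks_simps [simp]:
  "roks N []" "roks N (g # gs) \<longleftrightarrow> rok N g \<and> roks N gs"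
  "roks N (gs @ hs) \<longleftrightarrow> roks N gs \<and> roks N hs" "roks N (rev gs) \<longleftrightarrow> roks N gs"
  by (auto simp: roks_def)

definition ract :: "rgate list \<Rightarrow> asg \<Rightarrow> asg" where
  "ract gs s = fold ract1 gs s"

lemma ract_simps [simp]:
  "ract [] s = s" "ract (g # gs) s = ract gs (ract1 g s)"
  "ract (gs @ hs) s = ract hs (ract gs s)"
  by (auto simp: ract_def)

lemma ract1_ract1 [simp]:
  assumes "rok N g"
  shows "ract1 g (ract1 g s) = s"
proof
  show "ract1 g (ract1 g s) q = s q" for q
    using assms by (cases g) (simp_all, blast+)
qed

lemma ract_rev [simp]: "roks N gs \<Longrightarrow> ract (rev gs) (ract gs s) = s"
proof (induction gs arbitrary: s)
  case (Cons g gs)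
  then show ?case using ract1_ract1[of N g s] by simp
qed simp

lemma ract_rev2 [simp]: "roks N gs \<Longrightarrow> ract gs (ract (rev gs) s) = s"
  using ract_rev[of N "rev gs" s] by simp

text \<open>Evaluates an uncomputation by guessing the preimage and running the circuit forwards on
  it.\<close>

lemma ract_rev_eqI: "roks N gs \<Longrightarrow> ract gs t = s \<Longrightarrow> ract (rev gs) s = t"
  by auto

text \<open>The ripple-carry adder of Cuccaro et al.: the first three gates put the majority of the
  two summand bits and the carry into the first summand.\<close>
fun adder :: "nat \<Rightarrow> nat list \<Rightarrow> nat list \<Rightarrow> nat \<Rightarrow> rgate list" where
  "adder c (a # as) (b # bs) t =
     [RC a b, RC a c, RT c b a] @ adder a as bs t @ [RT c b a, RC a c, RC c b]"
| "adder c _ _ t = [RC c t]"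

text \<open>After the majority gates qubit \<open>a\<close> contains the outgoing carry and takes
  the place of \<open>c\<close> in the recursive call. Since \<open>t\<close> is the top bit of the
  target, the last carry is added to whatever \<open>t\<close> contains, and the sum is simply taken
  modulo \<open>2 ^ (length bs + 1)\<close>.\<close>

lemma ract_adder:
  assumes "length as = length bs" "distinct (c # as @ bs @ [t])"
  shows "ract (adder c as bs t) s =
    reg_set s (bs @ [t]) (reg_val s (bs @ [t]) + reg_val s as + of_bool (s c))"
  using assms
proof (induction as bs arbitrary: c s rule: list_induct2)
  case Nil
  then show ?case by auto
next
  case (Cons a as b bs)
  define s1 where "s1 = ract [RC a b, RC a c, RT c b a] s"
  have s1: "s1 = s(b := (s b \<noteq> s a), c := (s c \<noteq> s a),
      a := (s a \<noteq> ((s c \<noteq> s a) \<and> (s b \<noteq> s a))))"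
    using Cons.prems by (auto simp: s1_def fun_eq_iff)
  let ?X = "reg_val s (bs @ [t])" and ?Y = "reg_val s as"
  have "ract (adder a as bs t) s1 = reg_set s1 (bs @ [t]) (reg_val s1 (bs @ [t]) + reg_val s1 as + of_bool (s1 a))"
    by (rule Cons.IH) (use Cons.prems in auto)
  also have "reg_val s1 (bs @ [t]) = ?X" unfolding s1
    by (rule reg_val_cong) (use Cons.prems in auto)
  also have "reg_val s1 as = ?Y" unfolding s1
    by (rule reg_val_cong) (use Cons.prems in auto)
  finally have 2: "ract (adder a as bs t) s1 = reg_set s1 (bs @ [t]) (?X + ?Y + of_bool (s1 a))" .
  define w where "w = reg_set s (bs @ [t]) (?X + ?Y + of_bool (s1 a))"
  have w: "reg_set s1 (bs @ [t]) (?X + ?Y + of_bool (s1 a)) = w(b := s1 b, c := s1 c, a := s1 a)"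
    unfolding w_def s1 using Cons.prems by (auto simp: fun_eq_iff)
  have abc: "w a = s a" "w b = s b" "w c = s c" "a \<noteq> b" "a \<noteq> c" "b \<noteq> c"
    using Cons.prems by (auto simp: w_def)
  define V where "V = reg_val s ((b # bs) @ [t]) + reg_val s (a # as) + of_bool (s c)"
  have V: "V = of_bool (s b) + of_bool (s a) + of_bool (s c) + 2 * (?X + ?Y)"
    by (simp add: V_def)
  have "V div 2 = ?X + ?Y + of_bool (s1 a)"
    unfolding V s1 using abc by (cases "s a"; cases "s b"; cases "s c") auto
  moreover have "odd V = (s b \<noteq> (s a \<noteq> s c))"
    unfolding V using abc by (cases "s a"; cases "s b"; cases "s c") auto
  ultimately have R: "reg_set s ((b # bs) @ [t]) V = w(b := (s b \<noteq> (s a \<noteq> s c)))"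
    by (simp add: w_def)
  \<comment> \<open>Undoing the majority restores \<open>a\<close> and \<open>c\<close>; the last
    gate adds the incoming carry to \<open>b\<close>, which already holds the sum of the two
    digits.\<close>
  have "ract (adder c (a # as) (b # bs) t) s = ract [RT c b a, RC a c, RC c b] (w(b := s1 b, c := s1 c, a := s1 a))"
    using 2 w by (simp add: s1_def)
  also have "\<dots> = w(b := (s b \<noteq> (s a \<noteq> s c)))"
    using abc unfolding s1 by (auto simp: fun_eq_iff)
  finally show ?case using R V_def by simp
qed

lemma roks_adder:
  assumes "length as = length bs" "distinct (c # as @ bs @ [t])" "\<forall>q\<in>set (c # as @ bs @ [t]). q < N"
  shows "roks N (adder c as bs t)"
  using assms by (induction as bs arbitrary: c rule: list_induct2) auto

lemma length_adder: "length as = length bs \<Longrightarrow> length (adder c as bs t) = 6 * length bs + 1"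
  by (induction as bs arbitrary: c rule: list_induct2) auto

section \<open>Increments with a bounded number of clean qubits\<close>

text \<open>Adding \<open>of_bool (s c)\<close> by adding the dirty register \<open>g\<close> with carry \<open>c\<close> and then
  subtracting it with carry \<open>z\<close>.\<close>
definition incr :: "nat \<Rightarrow> nat \<Rightarrow> nat list \<Rightarrow> nat list \<Rightarrow> nat \<Rightarrow> rgate list" where
  "incr c z g bs t = adder c g bs t @ rev (adder z g bs t)"

lemma ract_incr:
  assumes "length g = length bs" "distinct (c # z # g @ bs @ [t])" "\<not> s z"
  shows "ract (incr c z g bs t) s = reg_set s (bs @ [t]) (reg_val s (bs @ [t]) + of_bool (s c))"
proof -
  obtain N where N: "\<forall>q\<in>set (c # z # g @ bs @ [t]). q < N"
    by (metis finite_nat_set_iff_bounded finite_set)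
  let ?w = "\<lambda>v. reg_set s (bs @ [t]) v"
  let ?v = "reg_val s (bs @ [t]) + of_bool (s c)"
  have ok: "roks N (adder z g bs t)" by (rule roks_adder) (use assms N in auto)
  have d: "set (bs @ [t]) \<inter> set g = {}" "set g \<inter> set (bs @ [t]) = {}" "z \<notin> set (bs @ [t])"
    "distinct (bs @ [t])"
    using assms(2) by auto
  have 1: "ract (adder c g bs t) s = ?w (reg_val s (bs @ [t]) + reg_val s g + of_bool (s c))"
    by (rule ract_adder) (use assms in auto)
  \<comment> \<open>The subtraction is checked forwards: adding \<open>g\<close> to the claimed
    result gives the same state as the adder with carry \<open>c\<close>, so reversing the second
    adder leads from that state to the claimed result.\<close>
  have "ract (adder z g bs t) (?w ?v) = reg_set (?w ?v) (bs @ [t])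
      (reg_val (?w ?v) (bs @ [t]) + reg_val (?w ?v) g + of_bool (?w ?v z))"
    by (rule ract_adder) (use assms in auto)
  also have "\<dots> = ?w (?v mod 2 ^ length (bs @ [t]) + reg_val s g)"
    using d assms(3) by (simp del: set_append length_append)
  also have "\<dots> = ?w (reg_val s (bs @ [t]) + reg_val s g + of_bool (s c))"
    by (rule reg_set_cong_mod) (simp add: mod_simps algebra_simps del: length_append)
  finally have "ract (rev (adder z g bs t)) (ract (adder c g bs t) s) = ?w ?v"
    using 1 ok by (metis ract_rev)
  then show ?thesis by (simp add: incr_def)
qed

lemma roks_incr:
  assumes "length g = length bs" "distinct (c # z # g @ bs @ [t])"
    "\<forall>q\<in>set (c # z # g @ bs @ [t]). q < N"
  shows "roks N (incr c z g bs t)"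
  unfolding incr_def using assms by (auto intro!: roks_adder)

lemma length_incr: "length g = length bs \<Longrightarrow> length (incr c z g bs t) = 12 * length bs + 2"
  by (simp add: incr_def length_adder)

lemma less_mult_imp_div_less_int: "(m::int) div n < i" if "m < i * n" "0 < n"
  by (smt (verit) that pos_imp_zdiv_nonneg_iff div_mult_mod_eq mult_right_mono pos_mod_sign)

text \<open>A register is increased by first computing the carry out of its lower half into \<open>c\<close>,
  adding \<open>c\<close> to the upper half, and uncomputing \<open>c\<close> while the lower half is still old.\<close>
lemma carry_split:
  assumes "distinct (xs @ ys @ [c])" "\<not> s c" "0 \<le> \<delta>" "\<delta> \<le> 2 ^ length xs"
    and s1: "s1 = reg_set s (xs @ [c]) (reg_val s (xs @ [c]) + \<delta>)"
    and s2: "s2 = reg_set s1 ys (reg_val s1 ys + of_bool (s1 c))"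
    and s3: "s3 = reg_set s2 (xs @ [c]) (reg_val s2 (xs @ [c]) - \<delta>)"
  shows "reg_set s3 xs (reg_val s3 xs + \<delta>) = reg_set s (xs @ ys) (reg_val s (xs @ ys) + \<delta>)" "\<not> s3 c"
proof -
  let ?k = "length xs" and ?v = "reg_val s xs" and ?u = "reg_val s ys"
  have v: "0 \<le> ?v" "?v < 2 ^ ?k" using reg_val_bounds by auto
  have rxc: "reg_val s (xs @ [c]) = ?v" using assms(2) by (simp add: reg_val_append)
  have d: "distinct (xs @ [c])" "set ys \<inter> set (xs @ [c]) = {}" "set (xs @ [c]) \<inter> set ys = {}"
    "c \<notin> set xs" "c \<notin> set ys" "set ys \<inter> set xs = {}" "distinct xs" "distinct ys"
    using assms(1) by auto
  have s1c: "of_bool (s1 c) = (?v + \<delta>) div 2 ^ ?k"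
  proof -
    have "s1 c \<longleftrightarrow> odd ((?v + \<delta>) div 2 ^ ?k)"
      unfolding s1 rxc using d(4) by (simp add: reg_set_append)
    moreover have "(?v + \<delta>) div 2 ^ ?k < 2"
      using v assms(4) by (intro less_mult_imp_div_less_int) simp_all
    moreover have "0 \<le> (?v + \<delta>) div 2 ^ ?k" using v assms(3) by (simp add: pos_imp_zdiv_nonneg_iff)
    ultimately show ?thesis
      by (smt (verit, ccfv_SIG) even_zero odd_one of_bool_eq(1) of_bool_eq(2))
  qed
  let ?U = "?u + (?v + \<delta>) div 2 ^ ?k"
  have s2': "s2 = reg_set (reg_set s (xs @ [c]) (?v + \<delta>)) ys ?U"
    using s2 s1c d(2) unfolding s1 rxc by (simp del: set_append)
  have r2: "reg_val s2 (xs @ [c]) = (?v + \<delta>) mod 2 ^ length (xs @ [c])"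
    unfolding s2' using d by (simp del: set_append length_append)
  have "s3 = reg_set (reg_set (reg_set s (xs @ [c]) (?v + \<delta>)) ys ?U) (xs @ [c]) ((?v + \<delta>) mod 2 ^ length (xs @ [c]) - \<delta>)"
    using s3 r2 s2' by simp
  also have "\<dots> = reg_set (reg_set (reg_set s (xs @ [c]) (?v + \<delta>)) ys ?U) (xs @ [c]) ?v"
    by (rule reg_set_cong_mod) (simp add: mod_simps del: length_append)
  also have "\<dots> = reg_set (reg_set (reg_set s ys ?U) (xs @ [c]) (?v + \<delta>)) (xs @ [c]) ?v"
    using reg_set_reg_set_disjoint[OF d(2)] by simp
  also have "\<dots> = reg_set (reg_set s ys ?U) (xs @ [c]) ?v" using d(1) by simp
  also have "\<dots> = reg_set s ys ?U"
    by (rule reg_set_reg_val_eq) (use d assms(2) in \<open>auto simp: reg_val_append\<close>)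
  finally have s3': "s3 = reg_set s ys ?U" .
  show "\<not> s3 c" unfolding s3' using d assms(2) by simp
  have "reg_val s3 xs = ?v" unfolding s3' using d by (intro reg_val_reg_set_disjoint) auto
  then have "reg_set s3 xs (reg_val s3 xs + \<delta>) = reg_set (reg_set s ys ?U) xs (?v + \<delta>)" unfolding s3' by simp
  moreover have "reg_set s (xs @ ys) (reg_val s (xs @ ys) + \<delta>) = reg_set (reg_set s ys ?U) xs (?v + \<delta>)"
  proof -
    have "(?v + 2 ^ ?k * ?u + \<delta>) div 2 ^ ?k = ?U"
    proof -
      have "?v + 2 ^ ?k * ?u + \<delta> = (?v + \<delta>) + ?u * 2 ^ ?k" by simp
      then show ?thesis by (simp only: div_mult_self1) simp
    qed
    moreover have "reg_set (reg_set s ys ?U) xs (?v + 2 ^ ?k * ?u + \<delta>) = reg_set (reg_set s ys ?U) xs (?v + \<delta>)"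
    proof (rule reg_set_cong_mod)
      have "?v + 2 ^ ?k * ?u + \<delta> = (?v + \<delta>) + ?u * 2 ^ ?k" by simp
      then show "(?v + 2 ^ ?k * ?u + \<delta>) mod 2 ^ ?k = (?v + \<delta>) mod 2 ^ ?k" by (simp only: mod_mult_self1)
    qed
    ultimately show ?thesis by (simp add: reg_set_append reg_val_append)
  qed
  ultimately show "reg_set s3 xs (reg_val s3 xs + \<delta>) = reg_set s (xs @ ys) (reg_val s (xs @ ys) + \<delta>)" by simp
qed

text \<open>The pieces stay abstract because the pattern is used with two kinds of arithmetic, dirty
  summands in \<open>cincr\<close> and scratch qubits in \<open>odd_shift\<close>. The predicate
  \<open>I\<close> collects what the pieces must know about clean and control qubits and survives
  all writes to the registers; it also keeps \<open>\<delta>\<close> the same in every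
  piece.\<close>

lemma ract_carry_split:
  assumes "distinct (xs @ ys @ [c])" "\<not> s c" "0 \<le> \<delta>" "\<delta> \<le> 2 ^ length xs" "roks N X"
    and X: "\<And>t. I t \<Longrightarrow> ract X t = reg_set t (xs @ [c]) (reg_val t (xs @ [c]) + \<delta>)"
    and Y: "\<And>t. I t \<Longrightarrow> ract Y t = reg_set t ys (reg_val t ys + of_bool (t c))"
    and Z: "\<And>t. I t \<Longrightarrow> \<not> t c \<Longrightarrow> ract Z t = reg_set t xs (reg_val t xs + \<delta>)"
    and Is: "I s" "\<And>t u. I t \<Longrightarrow> I (reg_set t (xs @ [c]) u)" "\<And>t u. I t \<Longrightarrow> I (reg_set t ys u)"
  shows "ract (X @ Y @ rev X @ Z) s = reg_set s (xs @ ys) (reg_val s (xs @ ys) + \<delta>)"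
proof -
  define s1 where "s1 = reg_set s (xs @ [c]) (reg_val s (xs @ [c]) + \<delta>)"
  define s2 where "s2 = reg_set s1 ys (reg_val s1 ys + of_bool (s1 c))"
  define s3 where "s3 = reg_set s2 (xs @ [c]) (reg_val s2 (xs @ [c]) - \<delta>)"
  note C = carry_split[OF assms(1-4) s1_def s2_def s3_def]
  have I: "I s1" "I s2" "I s3" unfolding s1_def s2_def s3_def using Is by auto
  have d: "distinct (xs @ [c])" using assms(1) by auto
  have "ract X s3 = reg_set s2 (xs @ [c]) (reg_val s3 (xs @ [c]) + \<delta>)"
    using X[OF I(3)] d unfolding s3_def by simp
  also have "\<dots> = reg_set s2 (xs @ [c]) (reg_val s2 (xs @ [c]))"
    by (rule reg_set_cong_mod) (use d in \<open>simp add: s3_def mod_simps del: length_append\<close>)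
  also have "\<dots> = s2" using d by simp
  finally have "ract (rev X) s2 = s3" using ract_rev[OF assms(5)] by metis
  moreover have "ract X s = s1" "ract Y s1 = s2" "ract Z s3 = reg_set s3 xs (reg_val s3 xs + \<delta>)"
    using X[OF Is(1)] Y[OF I(1)] Z[OF I(3) C(2)] by (simp_all add: s1_def s2_def)
  ultimately show ?thesis using C(1) by simp
qed

text \<open>\<open>c\<close> is the increment, \<open>z\<close> the zero carry of the subtractions,
  \<open>e\<close> the carry between the halves. Halving makes each half long enough to be the dirty
  summand for the other: \<open>incr\<close> wants a summand one shorter than its target, which
  leaves room for an upper half that is longer by one.\<close>

definition cincr :: "nat \<Rightarrow> nat \<Rightarrow> nat \<Rightarrow> nat list \<Rightarrow> rgate list" where
  "cincr c z e reg = (if reg = [] then [] else if length reg = 1 then [RC c (hd reg)] else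
     (let k = length reg div 2; xs = take k reg; ys = drop k reg; X = incr c z (take k ys) xs e
      in X @ incr e z (take (length ys - 1) xs) (butlast ys) (last ys)
       @ rev X @ incr c z (take (k - 1) ys) (butlast xs) (last xs)))"

lemma cincr_blocks:
  assumes "distinct (c # z # e # reg)" "2 \<le> length reg"
  defines "k \<equiv> length reg div 2"
  defines "xs \<equiv> take k reg" and "ys \<equiv> drop k reg"
  shows "cincr c z e reg = incr c z (take k ys) xs e
      @ incr e z (take (length ys - 1) xs) (butlast ys) (last ys)
      @ rev (incr c z (take k ys) xs e) @ incr c z (take (k - 1) ys) (butlast xs) (last xs)"
    "reg = xs @ ys" "1 \<le> k" "length xs = k" "k \<le> length ys" "length ys \<le> k + 1"
    "butlast xs @ [last xs] = xs" "butlast ys @ [last ys] = ys"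
    "distinct (c # z # take k ys @ xs @ [e])"
    "distinct (e # z # take (length ys - 1) xs @ butlast ys @ [last ys])"
    "distinct (c # z # take (k - 1) ys @ butlast xs @ [last xs])"
proof -
  show reg: "reg = xs @ ys" by (simp add: xs_def ys_def)
  show k: "1 \<le> k" "length xs = k" "k \<le> length ys" "length ys \<le> k + 1"
    using assms(2) by (auto simp: k_def xs_def ys_def)
  have ne: "xs \<noteq> []" "ys \<noteq> []" using k by auto
  show xs: "butlast xs @ [last xs] = xs" and ys: "butlast ys @ [last ys] = ys"
    using ne by auto
  have dr: "distinct (xs @ ys)" "c \<notin> set (xs @ ys)" "z \<notin> set (xs @ ys)" "e \<notin> set (xs @ ys)"
    "c \<noteq> z" "c \<noteq> e" "z \<noteq> e" using assms(1) reg by auto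
  have dt: "set (take i ys) \<inter> set xs = {}" "set (take i xs) \<inter> set ys = {}"
    "c \<notin> set (take i xs)" "c \<notin> set (take i ys)" "z \<notin> set (take i xs)" "z \<notin> set (take i ys)"
    "e \<notin> set (take i xs)" "e \<notin> set (take i ys)" "distinct (take i xs)" "distinct (take i ys)" for i
    using dr set_take_subset[of i xs] set_take_subset[of i ys] by auto
  show "distinct (c # z # take k ys @ xs @ [e])"
    using dr dt(1,4,6,8,10)[of k] by simp
  show "distinct (e # z # take (length ys - 1) xs @ butlast ys @ [last ys])"
    unfolding ys using dr dt(2,3,5,7,9)[of "length ys - 1"] by simp
  show "distinct (c # z # take (k - 1) ys @ butlast xs @ [last xs])"
    unfolding xs using dr dt(1,4,6,8,10)[of "k - 1"] by simp
  show "cincr c z e reg = incr c z (take k ys) xs e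
      @ incr e z (take (length ys - 1) xs) (butlast ys) (last ys)
      @ rev (incr c z (take k ys) xs e) @ incr c z (take (k - 1) ys) (butlast xs) (last xs)"
    using assms(2) by (auto simp: cincr_def Let_def k_def xs_def ys_def)
qed

lemma ract_cincr:
  assumes "distinct (c # z # e # reg)" "\<not> s z" "\<not> s e"
  shows "ract (cincr c z e reg) s = reg_set s reg (reg_val s reg + of_bool (s c))"
proof -
  consider "reg = []" | q where "reg = [q]" | "length reg \<ge> 2"
    by (cases reg; cases "tl reg") (auto simp: Suc_le_eq)
  then show ?thesis
  proof cases
    case 3
    define k xs ys where "k = length reg div 2" and "xs = take k reg" and "ys = drop k reg"
    note blocks = cincr_blocks[OF assms(1) 3, folded k_def, folded xs_def ys_def]
    note reg = blocks(2) and k = blocks(3-6) and xs = blocks(7) and ys = blocks(8)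
    note dX = blocks(9) and dY = blocks(10) and dZ = blocks(11)
    have dr: "distinct (xs @ ys)" "c \<notin> set (xs @ ys)" "z \<notin> set (xs @ ys)" "e \<notin> set (xs @ ys)"
      "c \<noteq> z" "c \<noteq> e" "z \<noteq> e" using assms(1) reg by auto
    obtain N where N: "\<forall>q\<in>set (c # z # e # reg). q < N"
      by (metis finite_nat_set_iff_bounded finite_set)
    \<comment> \<open>The control \<open>c\<close> has to keep its value: it is read before the
      upper half changes and again afterwards, by the inverse of \<open>?X\<close> and by
      \<open>?Z\<close>.\<close>
    let ?I = "\<lambda>t. \<not> t z \<and> t c = s c"
    let ?X = "incr c z (take k ys) xs e"
    let ?Y = "incr e z (take (length ys - 1) xs) (butlast ys) (last ys)"
    let ?Z = "incr c z (take (k - 1) ys) (butlast xs) (last xs)"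
    have "ract (?X @ ?Y @ rev ?X @ ?Z) s = reg_set s (xs @ ys) (reg_val s (xs @ ys) + of_bool (s c))"
    proof (rule ract_carry_split[where I = ?I and c = e and N = N])
      show "distinct (xs @ ys @ [e])" using dr by simp
      show "roks N ?X"
      proof (rule roks_incr[OF _ dX])
        show "\<forall>q\<in>set (c # z # take k ys @ xs @ [e]). q < N"
          using N reg set_take_subset[of k ys] by auto
      qed (use k(2,3) in simp)
      show "ract ?X t = reg_set t (xs @ [e]) (reg_val t (xs @ [e]) + of_bool (s c))" if "?I t" for t
      proof -
        have "length (take k ys) = length xs" using k(2,3) by simp
        from ract_incr[OF this dX, of t] that(1) show ?thesis by (simp only: simp_thms)
      qed
      show "ract ?Y t = reg_set t ys (reg_val t ys + of_bool (t e))" if "?I t" for t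
      proof -
        have "length (take (length ys - 1) xs) = length (butlast ys)" using k(2,4) by simp
        from ract_incr[OF this dY, of t] that show ?thesis by (simp only: simp_thms ys)
      qed
      show "ract ?Z t = reg_set t xs (reg_val t xs + of_bool (s c))" if "?I t" for t
      proof -
        have "length (take (k - 1) ys) = length (butlast xs)" using k(2,3) by simp
        from ract_incr[OF this dZ, of t] that show ?thesis by (simp only: simp_thms xs)
      qed
    qed (use assms dr k(2) in simp_all)
    then show ?thesis unfolding blocks(1) unfolding reg by simp
  qed (use assms in \<open>auto simp: cincr_def fun_eq_iff\<close>)
qed

lemma roks_cincr:
  assumes "distinct (c # z # e # reg)" "\<forall>q\<in>set (c # z # e # reg). q < N"
  shows "roks N (cincr c z e reg)"
proof -
  consider "reg = []" | q where "reg = [q]" | "length reg \<ge> 2"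
    by (cases reg; cases "tl reg") (auto simp: Suc_le_eq)
  then show ?thesis
  proof cases
    case 3
    define k xs ys where "k = length reg div 2" and "xs = take k reg" and "ys = drop k reg"
    note * = cincr_blocks[OF assms(1) 3, folded k_def, folded xs_def ys_def]
    have N: "q < N" if "q \<in> set xs \<or> q \<in> set ys \<or> q = c \<or> q = z \<or> q = e" for q
      using that assms(2) *(2) by auto
    have t: "q \<in> set xs" if "q \<in> set (take i xs)" for i q using that by (rule in_set_takeD)
    have t': "q \<in> set ys" if "q \<in> set (take i ys)" for i q using that by (rule in_set_takeD)
    have "roks N (incr c z (take k ys) xs e)"
      by (rule roks_incr[OF _ *(9)]) (use *(4,5) N t' in auto)
    moreover have "roks N (incr e z (take (length ys - 1) xs) (butlast ys) (last ys))"
    proof (rule roks_incr[OF _ *(10)])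
      show "length (take (length ys - 1) xs) = length (butlast ys)" using *(4,6) by simp
      show "\<forall>q\<in>set (e # z # take (length ys - 1) xs @ butlast ys @ [last ys]). q < N"
        unfolding *(8) using N t by auto
    qed
    moreover have "roks N (incr c z (take (k - 1) ys) (butlast xs) (last xs))"
    proof (rule roks_incr[OF _ *(11)])
      show "length (take (k - 1) ys) = length (butlast xs)" using *(4,5) by simp
      show "\<forall>q\<in>set (c # z # take (k - 1) ys @ butlast xs @ [last xs]). q < N"
        unfolding *(7) using N t' by auto
    qed
    ultimately show ?thesis unfolding *(1) by simp
  qed (use assms in \<open>auto simp: cincr_def\<close>)
qed

text \<open>Three circuits act on the lower half of length \<open>k\<close>, at about
  \<open>36 * k\<close> gates, and one on the upper half, at about \<open>12 * length ys\<close>;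
  since \<open>k \<le> length ys\<close>, this averages to at most \<open>24\<close> per
  qubit.\<close>

lemma length_cincr:
  assumes "distinct (c # z # e # reg)"
  shows "length (cincr c z e reg) \<le> 24 * length reg"
proof -
  consider "reg = []" | q where "reg = [q]" | "length reg \<ge> 2"
    by (cases reg; cases "tl reg") (auto simp: Suc_le_eq)
  then show ?thesis
  proof cases
    case 3
    define k xs ys where "k = length reg div 2" and "xs = take k reg" and "ys = drop k reg"
    note * = cincr_blocks[OF assms(1) 3, folded k_def, folded xs_def ys_def]
    have "length (incr c z (take k ys) xs e) = 12 * k + 2"
      by (subst length_incr) (use *(4,5) in auto)
    moreover have "length (incr e z (take (length ys - 1) xs) (butlast ys) (last ys)) = 12 * (length ys - 1) + 2"
      by (subst length_incr) (use *(4,6) in auto)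
    moreover have "length (incr c z (take (k - 1) ys) (butlast xs) (last xs)) = 12 * (k - 1) + 2"
      by (subst length_incr) (use *(4,5) in auto)
    moreover have "length reg = k + length ys" using *(2,4) by (metis length_append)
    ultimately show ?thesis unfolding *(1) using *(3,5,6) by simp
  qed (auto simp: cincr_def)
qed

section \<open>Conjunction of many qubits through overflow\<close>

lemma reg_val_all_ones: "reg_val s qs = 2 ^ length qs - 1 \<longleftrightarrow> (\<forall>q\<in>set qs. s q)"
proof (induction qs)
  case (Cons q qs)
  have "of_bool (s q) + 2 * reg_val s qs = 2 * 2 ^ length qs - 1 \<longleftrightarrow> s q \<and> reg_val s qs = 2 ^ length qs - 1"
    by (cases "s q") (simp_all, presburger+)
  then show ?case using Cons by simp
qed simp

text \<open>The first qubit of the conjunction serves as the carry into the remaining ones, so that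
  no clean qubit is needed to hold the constant one.\<close>
fun cand :: "nat \<Rightarrow> nat \<Rightarrow> nat \<Rightarrow> nat list \<Rightarrow> rgate list" where
  "cand z e f [] = [RX f]"
| "cand z e f (x # xs) = cincr x z e (xs @ [f]) @ rev (cincr x z e xs)"

text \<open>Incrementing the remaining qubits with \<open>f\<close> as top bit puts the overflow
  into \<open>f\<close>, and overflow happens only from the all-ones value with carry one. The
  inverse increment leaves \<open>f\<close> out, so it restores the register and keeps the
  overflow.\<close>

lemma ract_cand:
  assumes "distinct (z # e # f # xs)" "\<not> s z" "\<not> s e" "\<not> s f"
  shows "ract (cand z e f xs) s = s(f := (\<forall>q\<in>set xs. s q))"
proof (cases xs)
  case (Cons x ys)
  obtain N where N: "\<forall>q\<in>set (z # e # f # xs). q < N"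
    by (metis finite_nat_set_iff_bounded finite_set)
  let ?k = "length ys" and ?v = "reg_val s ys" and ?b = "of_bool (s x) :: int"
  have d: "distinct (x # z # e # ys @ [f])" "distinct (x # z # e # ys)" "f \<notin> set ys" "x \<noteq> f"
    "z \<noteq> f" "e \<noteq> f"
    using assms(1) Cons by auto
  have "ract (cincr x z e (ys @ [f])) s = reg_set s (ys @ [f]) (?v + ?b)"
    using ract_cincr[OF d(1) assms(2,3)] assms(4) by (simp add: reg_val_append)
  also have "\<dots> = (reg_set s ys (?v + ?b))(f := odd ((?v + ?b) div 2 ^ ?k))"
    using d(3) by (simp add: reg_set_append)
  finally have 1: "ract (cincr x z e (ys @ [f])) s = (reg_set s ys (?v + ?b))(f := odd ((?v + ?b) div 2 ^ ?k))" .
  let ?t = "s(f := odd ((?v + ?b) div 2 ^ ?k))"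
  have "ract (cincr x z e ys) ?t = reg_set ?t ys (reg_val ?t ys + of_bool (?t x))"
    by (rule ract_cincr[OF d(2)]) (use d assms in auto)
  also have "\<dots> = ract (cincr x z e (ys @ [f])) s" using 1 d by simp
  finally have 2: "ract (cand z e f xs) s = ?t"
    using ract_rev_eqI[OF roks_cincr[OF d(2), of N], of ?t] N Cons by simp
  have v: "0 \<le> ?v" "?v < 2 ^ ?k" using reg_val_bounds by auto
  have "odd ((?v + ?b) div 2 ^ ?k) \<longleftrightarrow> s x \<and> ?v = 2 ^ ?k - 1"
  proof (cases "s x \<and> ?v = 2 ^ ?k - 1")
    case False
    then have "?v + ?b < 2 ^ ?k" using v by (cases "s x") auto
    then have "(?v + ?b) div 2 ^ ?k = 0" using v by (intro div_pos_pos_trivial) auto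
    then show ?thesis using False by simp
  qed simp
  then show ?thesis using 2 Cons reg_val_all_ones[of s ys] by simp
qed (use assms in auto)

lemma roks_cand:
  assumes "distinct (z # e # f # xs)" "\<forall>q\<in>set (z # e # f # xs). q < N"
  shows "roks N (cand z e f xs)"
  using assms by (cases xs) (auto intro!: roks_cincr)

lemma length_cand:
  assumes "distinct (z # e # f # xs)"
  shows "length (cand z e f xs) \<le> 48 * length xs + 1"
proof (cases xs)
  case (Cons x ys)
  have "distinct (x # z # e # ys @ [f])" "distinct (x # z # e # ys)" using assms Cons by auto
  from this[THEN length_cincr] show ?thesis using Cons by simp
qed simp

section \<open>Increment and comparison on short registers with scratch qubits\<close>

text \<open>The carries are kept in the clean qubits \<open>as\<close>, one for each inner carry,
  which takes only three gates per bit. On the way back a carry is erased while its bit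
  \<open>b\<close> still has the old value, and only then is \<open>b\<close> flipped.\<close>

fun ladder :: "nat \<Rightarrow> nat list \<Rightarrow> nat list \<Rightarrow> rgate list" where
  "ladder c [] as = []"
| "ladder c [b] as = [RC c b]"
| "ladder c (b # b' # bs) (a # as) = [RT c b a] @ ladder a (b' # bs) as @ [RT c b a, RC c b]"
| "ladder c (b # b' # bs) [] = []"

lemma ract_ladder:
  assumes "length bs \<le> length as + 1" "distinct (c # bs @ as)" "\<forall>a\<in>set as. \<not> s a"
  shows "ract (ladder c bs as) s = reg_set s bs (reg_val s bs + of_bool (s c))"
  using assms
proof (induction c bs as arbitrary: s rule: ladder.induct)
  case (3 c b b' bs a as)
  let ?X = "reg_val s (b' # bs)" and ?s1 = "s(a := (s c \<and> s b))"
  have d: "a \<notin> set (b' # bs)" "b \<notin> set (b' # bs)" "c \<notin> set (b' # bs)" "a \<noteq> b" "a \<noteq> c" "b \<noteq> c"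
    "\<not> s a"
    using 3(3,4) by auto
  have "ract (ladder a (b' # bs) as) ?s1 = reg_set ?s1 (b' # bs) (reg_val ?s1 (b' # bs) + of_bool (?s1 a))"
    by (rule 3(1)) (use 3(2,3,4) in auto)
  also have "\<dots> = (reg_set s (b' # bs) (?X + of_bool (s c \<and> s b)))(a := (s c \<and> s b))"
    by (simp only: reg_val_upd[OF d(1)] reg_set_upd[OF d(1)] fun_upd_same)
  finally have 1: "ract (ladder a (b' # bs) as) ?s1 = (reg_set s (b' # bs) (?X + of_bool (s c \<and> s b)))(a := (s c \<and> s b))" .
  let ?w = "reg_set s (b' # bs) (?X + of_bool (s c \<and> s b))"
  have w: "?w a = False" "?w b = s b" "?w c = s c"
    using d(7) by (simp_all only: reg_set_other[OF d(1)] reg_set_other[OF d(2)] reg_set_other[OF d(3)])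
  define V where "V = reg_val s (b # b' # bs) + of_bool (s c)"
  have V: "V = of_bool (s b) + of_bool (s c) + 2 * ?X" unfolding V_def by simp
  have "V div 2 = ?X + of_bool (s c \<and> s b)" "odd V = (s b \<noteq> s c)"
    unfolding V by (cases "s b"; cases "s c"; simp del: reg_val.simps)+
  then have R: "reg_set s (b # b' # bs) V = ?w(b := (s b \<noteq> s c))"
    by (simp only: reg_set.simps(2)[of s b])
  have 2: "ract1 (RT c b a) s = ?s1" using d by simp
  have "ract (ladder c (b # b' # bs) (a # as)) s
      = ract [RT c b a, RC c b] (ract (ladder a (b' # bs) as) ?s1)"
    using d by simp
  also have "\<dots> = ?w(b := (s b \<noteq> s c))"
    unfolding 1 using d w by (simp del: reg_set.simps add: fun_upd_twist fun_upd_idem)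
  finally show ?case using R V_def by simp
qed auto

lemma roks_ladder:
  assumes "distinct (c # bs @ as)" "\<forall>q\<in>set (c # bs @ as). q < N"
  shows "roks N (ladder c bs as)"
  using assms by (induction c bs as rule: ladder.induct) auto

lemma length_ladder: "length (ladder c bs as) \<le> 3 * length bs"
  by (induction c bs as rule: ladder.induct) auto

text \<open>The borrow \<open>b < j mod 2 + c\<close> of one digit, written into the clean qubit
  \<open>a\<close>: it is \<open>\<not> b \<and> c\<close> for an even digit and
  \<open>\<not> (b \<and> \<not> c)\<close> for an odd one. The constant \<open>j\<close> is wired
  into the circuit and occupies no qubits.\<close>

fun cmp_step :: "int \<Rightarrow> nat \<Rightarrow> nat \<Rightarrow> nat \<Rightarrow> rgate list" where
  "cmp_step j c b a = (if even j then [RX b, RT c b a, RX b] else [RX c, RT c b a, RX a, RX c])"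

fun cmp :: "nat \<Rightarrow> nat list \<Rightarrow> nat list \<Rightarrow> int \<Rightarrow> nat \<Rightarrow> rgate list" where
  "cmp c (b # bs) (a # as) j t = cmp_step j c b a @ cmp a bs as (j div 2) t @ rev (cmp_step j c b a)"
| "cmp c _ _ j t = [RC c t]"

text \<open>If \<open>v\<close> is the borrow of the lowest digit, then
  \<open>b + 2 * x < j + c\<close> is equivalent to \<open>x < j div 2 + v\<close>, so the
  comparison proceeds from the least significant end. The borrows are erased on the way back and
  only \<open>t\<close> keeps the outcome.\<close>

lemma ract_cmp:
  assumes "length bs = length as" "distinct (t # c # bs @ as)" "\<forall>a\<in>set as. \<not> s a"
    "0 \<le> j" "j < 2 ^ length bs"
  shows "ract (cmp c bs as j t) s = s(t := (s t \<noteq> (reg_val s bs < j + of_bool (s c))))"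
  using assms
proof (induction bs as arbitrary: c j s rule: list_induct2)
  case (Cons b bs a as)
  have d: "a \<noteq> b" "a \<noteq> c" "b \<noteq> c" "t \<noteq> a" "t \<noteq> b" "t \<noteq> c" "\<not> s a" "a \<notin> set bs"
    using Cons.prems by auto
  let ?v = "of_bool (s b) < j mod 2 + of_bool (s c)"
  have step: "ract (cmp_step j c b a) u = u(a := ?v)" if "\<not> u a" "u b = s b" "u c = s c" for u
  proof
    fix q
    show "ract (cmp_step j c b a) u q = (u(a := ?v)) q"
      using d(1-3) that by (cases "s b"; cases "s c"; auto simp: even_iff_mod_2_eq_zero odd_iff_mod_2_eq_one)
  qed
  let ?s1 = "s(a := ?v)"
  let ?r = "reg_val s bs < j div 2 + of_bool ?v"
  have "ract (cmp a bs as (j div 2) t) ?s1 = ?s1(t := (?s1 t \<noteq> (reg_val ?s1 bs < j div 2 + of_bool (?s1 a))))"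
    by (rule Cons.IH) (use Cons.prems in auto)
  also have "\<dots> = (s(t := (s t \<noteq> ?r)))(a := ?v)"
    using d by (simp add: fun_upd_twist)
  finally have 1: "ract (cmp a bs as (j div 2) t) ?s1 = (s(t := (s t \<noteq> ?r)))(a := ?v)" .
  have 2: "ract (cmp_step j c b a) (s(t := (s t \<noteq> ?r))) = (s(t := (s t \<noteq> ?r)))(a := ?v)"
    by (rule step) (use d in auto)
  have "roks (Suc (a + b + c)) (cmp_step j c b a)" using d(1-3) by auto
  from ract_rev_eqI[OF this 2]
  have "ract (cmp c (b # bs) (a # as) j t) s = s(t := (s t \<noteq> ?r))"
    using step[of s] d 1 by simp
  moreover have "?r \<longleftrightarrow> reg_val s (b # bs) < j + of_bool (s c)"
  proof -
    have "j = j mod 2 + 2 * (j div 2)" by simp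
    moreover have "j mod 2 = 0 \<or> j mod 2 = 1" by auto
    ultimately show ?thesis by (cases "s b"; cases "s c"; simp; presburger)
  qed
  ultimately show ?case by simp
qed auto

lemma roks_cmp:
  assumes "length bs = length as" "distinct (t # c # bs @ as)" "\<forall>q\<in>set (t # c # bs @ as). q < N"
  shows "roks N (cmp c bs as j t)"
  using assms by (induction bs as arbitrary: c j rule: list_induct2) auto

lemma length_cmp: "length bs = length as \<Longrightarrow> length (cmp c bs as j t) \<le> 8 * length bs + 1"
proof (induction bs as arbitrary: c j rule: list_induct2)
  case (Cons b bs a as)
  show ?case using Cons.IH[of a "j div 2"] by simp
qed simp

section \<open>Action of circuits on amplitudes\<close>

text \<open>The amplitude at \<open>s\<close> after a gate is given by the row of its matrix at
  \<open>s\<close>. A Toffoli gate is an involution, so evaluating at its image is the same as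
  evaluating at its preimage.\<close>

fun run1 :: "gate \<Rightarrow> (asg \<Rightarrow> complex) \<Rightarrow> asg \<Rightarrow> complex" where
  "run1 (Gate1 U q) \<psi> s = (\<Sum>b\<in>UNIV. U $$ (of_bool (s q), of_bool b) * \<psi> (s(q := b)))"
| "run1 (Gate2 U q1 q2) \<psi> s = (\<Sum>b1\<in>UNIV. \<Sum>b2\<in>UNIV.
     U $$ (2 * of_bool (s q1) + of_bool (s q2), 2 * of_bool b1 + of_bool b2) * \<psi> (s(q1 := b1, q2 := b2)))"
| "run1 (Toffoli c1 c2 t) \<psi> s = \<psi> (s(t := (s t \<noteq> (s c1 \<and> s c2))))"

definition run :: "gate list \<Rightarrow> (asg \<Rightarrow> complex) \<Rightarrow> asg \<Rightarrow> complex" where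
  "run gs = fold run1 gs"

lemma run_simps [simp]:
  "run [] \<psi> = \<psi>" "run (g # gs) \<psi> = run gs (run1 g \<psi>)" "run (gs @ hs) \<psi> = run hs (run gs \<psi>)"
  by (simp_all add: run_def)

section \<open>Matrix indices as assignments\<close>

definition low :: "nat \<Rightarrow> asg set" where
  "low m = {s. \<forall>q\<ge>m. \<not> s q}"

lemma bit_reg_val: "bit (reg_val s [0..<m]) q \<longleftrightarrow> s q" if "q < m"
proof -
  have "reg_set s [0..<m] (reg_val s [0..<m]) q = s q" by simp
  then show ?thesis using that by (simp only: reg_set_upt) simp
qed

text \<open>Binary expansion is the bridge between matrices and amplitudes: it turns sums over
  columns into sums over assignments.\<close>

lemma bij_bits: "bij_betw (bit :: nat \<Rightarrow> asg) {..<2 ^ m} (low m)"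
proof (rule bij_betwI')
  show "bit x = bit y \<longleftrightarrow> x = y" for x y :: nat
    by (auto intro: bit_eqI)
  show "bit x \<in> low m" if "x \<in> {..<2 ^ m}" for x :: nat
  proof -
    have "take_bit m x = x" using that by (simp add: take_bit_nat_eq_self)
    moreover have "\<not> bit (take_bit m x) q" if "m \<le> q" for q
      using that by (simp add: bit_take_bit_iff)
    ultimately show ?thesis by (simp add: low_def)
  qed
  show "\<exists>x\<in>{..<2 ^ m}. s = bit (x::nat)" if s: "s \<in> low m" for s
  proof
    let ?v = "reg_val s [0..<m]"
    have v: "0 \<le> ?v" "?v < 2 ^ m" using reg_val_bounds[of s "[0..<m]"] by auto
    have t: "nat ?v < 2 ^ m" using v by (simp add: nat_less_iff)
    then show "nat ?v \<in> {..<2 ^ m}" by simp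
    show "s = bit (nat ?v)"
    proof
      fix q
      show "s q = bit (nat ?v) q"
      proof (cases "q < m")
        case True
        then show ?thesis using v bit_reg_val[of q m s] by (simp add: bit_nat_iff)
      next
        case False
        have "take_bit m (nat ?v) = nat ?v" using t by (simp add: take_bit_nat_eq_self)
        moreover have "\<not> bit (take_bit m (nat ?v)) q" using False by (simp add: bit_take_bit_iff)
        ultimately have "\<not> bit (nat ?v) q" by simp
        then show ?thesis using s False by (auto simp: low_def)
      qed
    qed
  qed
qed

lemma finite_low: "finite (low m)"
  using bij_betw_finite[OF bij_bits] by blast

lemma sum_bits: "(\<Sum>c<2 ^ m. F (bit (c::nat))) = (\<Sum>s\<in>low m. F s)"
  by (rule sum.reindex_bij_betw[OF bij_bits])

lemma bit_low: "r < 2 ^ m \<Longrightarrow> bit (r::nat) \<in> low m"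
  by (rule bij_betwE[OF bij_bits, rule_format]) simp

lemma bit_inject: "bit (x::nat) = bit y \<longleftrightarrow> x = y"
  by (auto intro: bit_eqI)

lemma qbit_bit: "qbit x q = of_bool (bit x q)"
  by (simp add: qbit_def bit_iff_odd mod_2_eq_odd)

lemma bit_flip_bit: "bit (flip_bit c t) = (bit c)(t := \<not> bit c t)"
proof (cases "bit c t")
  case True
  have "c = set_bit t (unset_bit t c)"
    by (rule bit_eqI) (use True in \<open>auto simp: bit_simps\<close>)
  also have "\<dots> = unset_bit t c + 2 ^ t" by (simp add: set_bit_eq bit_simps)
  finally have "flip_bit c t = unset_bit t c"
    using True by (simp add: flip_bit_def qbit_bit)
  then show ?thesis using True by (auto simp: fun_eq_iff bit_simps)
next
  case False
  then have "flip_bit c t = set_bit t c"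
    by (simp add: flip_bit_def qbit_bit set_bit_eq)
  then show ?thesis using False by (auto simp: fun_eq_iff bit_simps)
qed

lemma flip_less: "c < 2 ^ m \<Longrightarrow> t < m \<Longrightarrow> flip_bit c t < 2 ^ m"
proof -
  assume "c < 2 ^ m" "t < m"
  then have "bit (flip_bit c t) \<in> low m"
    using bit_low[of c m] by (auto simp: bit_flip_bit low_def)
  then obtain x :: nat where "x < 2 ^ m" "bit x = bit (flip_bit c t)"
    using bij_betw_imp_surj_on[OF bij_bits[of m]] by (metis (no_types, lifting) imageE lessThan_iff)
  then show ?thesis by (simp add: bit_inject)
qed

text \<open>Row \<open>r\<close> vanishes except at assignments that differ from
  \<open>bit r\<close> at most in the qubits acted on, so the sum over all columns collapses to the
  one, two or four terms of \<open>run1\<close>.\<close>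

lemma gate_mat_run1:
  assumes "gate_ok m g" "r < 2 ^ m"
  shows "(\<Sum>c<2 ^ m. gate_mat m g $$ (r, c) * \<psi> (bit c)) = run1 g \<psi> (bit r)"
proof (cases g)
  case (Gate1 U q)
  let ?s = "bit r :: asg"
  let ?A = "\<lambda>s. \<forall>p<m. p \<noteq> q \<longrightarrow> ?s p = s p"
  let ?F = "\<lambda>s. (if ?A s then U $$ (of_bool (?s q), of_bool (s q)) else 0) * \<psi> s"
  have q: "q < m" using assms Gate1 by simp
  have s: "?s \<in> low m" by (rule bit_low[OF assms(2)])
  have "(\<Sum>c<2 ^ m. gate_mat m g $$ (r, c) * \<psi> (bit c)) = (\<Sum>c<2 ^ m. ?F (bit (c::nat)))"
  proof (rule sum.cong)
    fix c :: nat
    assume "c \<in> {..<2 ^ m}"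
    then have "gate_mat m g $$ (r, c) =
        (if \<forall>p<m. p \<noteq> q \<longrightarrow> qbit r p = qbit c p then U $$ (qbit r q, qbit c q) else 0)"
      using assms(2) Gate1 by simp
    then show "gate_mat m g $$ (r, c) * \<psi> (bit c) = ?F (bit c)"
      by (simp only: qbit_bit of_bool_eq_iff)
  qed simp
  also have "\<dots> = (\<Sum>s\<in>low m. ?F s)" by (rule sum_bits)
  also have "\<dots> = (\<Sum>s\<in>range (\<lambda>b. ?s(q := b)). ?F s)"
  proof (rule sum.mono_neutral_right[OF finite_low])
    show "range (\<lambda>b. ?s(q := b)) \<subseteq> low m" using s q by (auto simp: low_def)
    show "\<forall>i\<in>low m - range (\<lambda>b. ?s(q := b)). ?F i = 0"
    proof
      fix t assume "t \<in> low m - range (\<lambda>b. ?s(q := b))"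
      then have tl: "t \<in> low m" and tr: "t \<notin> range (\<lambda>b. ?s(q := b))" by auto
      have "t = ?s(q := t q)" if A: "?A t"
      proof
        show "t p = (?s(q := t q)) p" for p
          using A s tl by (cases "p < m") (auto simp: low_def)
      qed
      then have "\<not> ?A t" using tr by blast
      then show "?F t = 0" by (simp only: if_False mult_zero_left)
    qed
  qed
  also have "\<dots> = (\<Sum>b\<in>UNIV. ?F (?s(q := b)))"
    by (subst sum.reindex) (auto simp: inj_on_def dest: fun_upd_eqD)
  also have "\<dots> = run1 g \<psi> ?s" using Gate1 by simp
  finally show ?thesis .
next
  case (Gate2 U q1 q2)
  let ?s = "bit r :: asg"
  let ?A = "\<lambda>s. \<forall>p<m. p \<noteq> q1 \<and> p \<noteq> q2 \<longrightarrow> ?s p = s p"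
  let ?F = "\<lambda>s. (if ?A s then U $$ (2 * of_bool (?s q1) + of_bool (?s q2), 2 * of_bool (s q1) + of_bool (s q2)) else 0) * \<psi> s"
  let ?h = "\<lambda>(b1, b2). ?s(q1 := b1, q2 := b2)"
  have q: "q1 < m" "q2 < m" "q1 \<noteq> q2" using assms Gate2 by auto
  have s: "?s \<in> low m" by (rule bit_low[OF assms(2)])
  have "(\<Sum>c<2 ^ m. gate_mat m g $$ (r, c) * \<psi> (bit c)) = (\<Sum>c<2 ^ m. ?F (bit (c::nat)))"
  proof (rule sum.cong)
    fix c :: nat
    assume "c \<in> {..<2 ^ m}"
    then have "gate_mat m g $$ (r, c) =
        (if \<forall>p<m. p \<noteq> q1 \<and> p \<noteq> q2 \<longrightarrow> qbit r p = qbit c p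
          then U $$ (2 * qbit r q1 + qbit r q2, 2 * qbit c q1 + qbit c q2) else 0)"
      using assms(2) Gate2 by simp
    then show "gate_mat m g $$ (r, c) * \<psi> (bit c) = ?F (bit c)"
      by (simp only: qbit_bit of_bool_eq_iff)
  qed simp
  also have "\<dots> = (\<Sum>s\<in>low m. ?F s)" by (rule sum_bits)
  also have "\<dots> = (\<Sum>s\<in>range ?h. ?F s)"
  proof (rule sum.mono_neutral_right[OF finite_low])
    show "range ?h \<subseteq> low m" using s q by (auto simp: low_def)
    show "\<forall>i\<in>low m - range ?h. ?F i = 0"
    proof
      fix t assume "t \<in> low m - range ?h"
      then have tl: "t \<in> low m" and tr: "t \<notin> range ?h" by auto
      have "t = ?h (t q1, t q2)" if A: "?A t"
      proof
        show "t p = ?h (t q1, t q2) p" for p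
          using A s tl by (cases "p < m") (auto simp: low_def)
      qed
      then have "\<not> ?A t" using tr by blast
      then show "?F t = 0" by (simp only: if_False mult_zero_left)
    qed
  qed
  also have "\<dots> = (\<Sum>b\<in>UNIV. ?F (?h b))"
    by (subst sum.reindex) (use q in \<open>auto simp: inj_on_def fun_eq_iff split: if_splits\<close>)
  also have "\<dots> = (\<Sum>b\<in>UNIV \<times> UNIV. ?F (?h b))" by simp
  also have "\<dots> = (\<Sum>b1\<in>UNIV. \<Sum>b2\<in>UNIV. ?F (?h (b1, b2)))"
    by (subst sum.cartesian_product) (auto intro: sum.cong)
  also have "\<dots> = run1 g \<psi> ?s" using Gate2 q by simp
  finally show ?thesis .
next
  case (Toffoli c1 c2 t)
  let ?c = "if bit r c1 \<and> bit r c2 then flip_bit r t else r"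
  have d: "c1 < m" "c2 < m" "t < m" "c1 \<noteq> t" "c2 \<noteq> t" using assms Toffoli by auto
  have c: "?c < 2 ^ m" using assms(2) d flip_less by simp
  have bc: "bit ?c = (bit r)(t := (bit r t \<noteq> (bit r c1 \<and> bit r c2)))"
    by (simp add: bit_flip_bit fun_upd_idem)
  \<comment> \<open>The matrix is described by its columns; because the gate is an involution, row
    \<open>r\<close> has its only entry in the column reached from \<open>r\<close>.\<close>
  have iff: "(r = (if qbit c c1 = 1 \<and> qbit c c2 = 1 then flip_bit c t else c)) \<longleftrightarrow> c = ?c" for c
  proof -
    have "(r = (if qbit c c1 = 1 \<and> qbit c c2 = 1 then flip_bit c t else c)) \<longleftrightarrow>
        bit r = (bit c)(t := (bit c t \<noteq> (bit c c1 \<and> bit c c2)))"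
      by (subst bit_inject[symmetric]) (simp add: qbit_bit bit_flip_bit fun_upd_idem)
    also have "\<dots> \<longleftrightarrow> bit c = (bit r)(t := (bit r t \<noteq> (bit r c1 \<and> bit r c2)))"
    proof -
      have "u = v(t := (v t \<noteq> (v c1 \<and> v c2)))" if "v = u(t := (u t \<noteq> (u c1 \<and> u c2)))" for u v :: asg
      proof
        show "u p = (v(t := (v t \<noteq> (v c1 \<and> v c2)))) p" for p
          using d unfolding that by (cases "p = t") auto
      qed
      then show ?thesis by blast
    qed
    also have "\<dots> \<longleftrightarrow> c = ?c" unfolding bc[symmetric] bit_inject ..
    finally show ?thesis .
  qed
  have "(\<Sum>c<2 ^ m. gate_mat m g $$ (r, c) * \<psi> (bit c)) = (\<Sum>c<2 ^ m. if c = ?c then \<psi> (bit c) else 0)"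
  proof (rule sum.cong)
    fix c :: nat
    assume "c \<in> {..<2 ^ m}"
    then have "gate_mat m g $$ (r, c) =
        (if r = (if qbit c c1 = 1 \<and> qbit c c2 = 1 then flip_bit c t else c) then 1 else 0)"
      using assms(2) Toffoli by simp
    then show "gate_mat m g $$ (r, c) * \<psi> (bit c) = (if c = ?c then \<psi> (bit c) else 0)"
      unfolding iff by simp
  qed simp
  also have "\<dots> = \<psi> (bit ?c)" using c by (simp add: sum.delta)
  finally show ?thesis using Toffoli bc by simp
qed

lemma circuit_mat_run:
  assumes "\<forall>g\<in>set gs. gate_ok m g" "r < 2 ^ m" "c < 2 ^ m"
  shows "circuit_mat m gs \<in> carrier_mat (2 ^ m) (2 ^ m)"
    "circuit_mat m gs $$ (r, c) = run gs (\<lambda>s. of_bool (s = bit c)) (bit r)"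
proof -
  have "circuit_mat m gs \<in> carrier_mat (2 ^ m) (2 ^ m) \<and>
    (\<forall>r<2 ^ m. circuit_mat m gs $$ (r, c) = run gs (\<lambda>s. of_bool (s = bit c)) (bit r))"
    using assms(1)
  proof (induction gs rule: rev_induct)
    case Nil
    show ?case using assms(3) by (auto simp: circuit_mat_def bit_inject)
  next
    case (snoc g gs)
    let ?A = "circuit_mat m gs" and ?\<psi> = "run gs (\<lambda>s. of_bool (s = bit c))"
    have eq: "circuit_mat m (gs @ [g]) = gate_mat m g * ?A" by (simp add: circuit_mat_def)
    have A: "?A \<in> carrier_mat (2 ^ m) (2 ^ m)" and
      IH: "\<And>r. r < 2 ^ m \<Longrightarrow> ?A $$ (r, c) = ?\<psi> (bit r)" using snoc by auto
    have G: "gate_mat m g \<in> carrier_mat (2 ^ m) (2 ^ m)" by (cases g) auto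
    have "(gate_mat m g * ?A) $$ (r, c) = run1 g ?\<psi> (bit r)" if r: "r < 2 ^ m" for r
    proof -
      have "(gate_mat m g * ?A) $$ (r, c) = (\<Sum>k<2 ^ m. gate_mat m g $$ (r, k) * ?A $$ (k, c))"
        using A G r assms(3) by (simp add: scalar_prod_def lessThan_atLeast0)
      also have "\<dots> = (\<Sum>k<2 ^ m. gate_mat m g $$ (r, k) * ?\<psi> (bit k))"
        by (rule sum.cong) (auto simp: IH)
      also have "\<dots> = run1 g ?\<psi> (bit r)"
        by (rule gate_mat_run1) (use snoc r in auto)
      finally show ?thesis .
    qed
    then show ?case using A G by (simp add: eq)
  qed
  then show "circuit_mat m gs \<in> carrier_mat (2 ^ m) (2 ^ m)"
    "circuit_mat m gs $$ (r, c) = run gs (\<lambda>s. of_bool (s = bit c)) (bit r)"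
    using assms by auto
qed

section \<open>Gates from real orthogonal two-by-two matrices\<close>

definition orth :: "(bool \<Rightarrow> bool \<Rightarrow> real) \<Rightarrow> bool" where
  "orth A \<longleftrightarrow> (\<forall>p q. (\<Sum>r\<in>UNIV. A p r * A q r) = of_bool (p = q))"

definition plain :: "(bool \<Rightarrow> bool \<Rightarrow> real) \<Rightarrow> complex mat" where
  "plain A = mat 2 2 (\<lambda>(i, j). complex_of_real (A (i = 1) (j = 1)))"

text \<open>\<open>Gate2\<close> uses its first qubit as the higher bit of the matrix index, so
  \<open>2\<close> and \<open>3\<close> are the indices with the control set.\<close>

definition controlled :: "(bool \<Rightarrow> bool \<Rightarrow> real) \<Rightarrow> complex mat" where
  "controlled A = mat 4 4 (\<lambda>(i, j). if 2 \<le> i \<and> 2 \<le> j then complex_of_real (A (i = 3) (j = 3))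
     else of_bool (i = j))"

lemma orthD:
  assumes "orth A"
  shows "A False False * A False False + A False True * A False True = 1"
    "A True False * A True False + A True True * A True True = 1"
    "A False False * A True False + A False True * A True True = 0"
    "A True False * A False False + A True True * A False True = 0"
  using assms[unfolded orth_def, rule_format, of False False]
    assms[unfolded orth_def, rule_format, of True True]
    assms[unfolded orth_def, rule_format, of False True]
    assms[unfolded orth_def, rule_format, of True False]
  by (simp_all add: UNIV_bool algebra_simps)

lemma unitary_plain:
  assumes "orth A"
  shows "unitary_mat 2 (plain A)"
  unfolding unitary_mat_def
proof
  show "plain A * mat 2 2 (\<lambda>(i, j). cnj (plain A $$ (j, i))) = 1\<^sub>m 2"
  proof (rule eq_matI)
    fix i j :: nat
    assume "i < dim_row (1\<^sub>m 2)" "j < dim_col (1\<^sub>m 2)"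
    then have ij: "i < 2" "j < 2" by auto
    then have "i = 0 \<or> i = 1" "j = 0 \<or> j = 1" by auto
    then show "(plain A * mat 2 2 (\<lambda>(i, j). cnj (plain A $$ (j, i)))) $$ (i, j) = (1\<^sub>m 2 :: complex mat) $$ (i, j)"
      using orthD[OF assms]
      by (auto simp: plain_def scalar_prod_def numeral_2_eq_2 simp flip: of_real_mult of_real_add)
  qed (auto simp: plain_def)
qed (simp add: plain_def)

lemma unitary_controlled:
  assumes "orth A"
  shows "unitary_mat 4 (controlled A)"
  unfolding unitary_mat_def
proof
  show "controlled A * mat 4 4 (\<lambda>(i, j). cnj (controlled A $$ (j, i))) = 1\<^sub>m 4"
  proof (rule eq_matI)
    fix i j :: nat
    assume "i < dim_row (1\<^sub>m 4)" "j < dim_col (1\<^sub>m 4)"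
    then have ij: "i < 4" "j < 4" by auto
    then have "i = 0 \<or> i = 1 \<or> i = 2 \<or> i = 3" "j = 0 \<or> j = 1 \<or> j = 2 \<or> j = 3" by auto
    moreover have "{0..<4} = {0::nat, 1, 2, 3}" by auto
    ultimately show "(controlled A * mat 4 4 (\<lambda>(i, j). cnj (controlled A $$ (j, i)))) $$ (i, j) = (1\<^sub>m 4 :: complex mat) $$ (i, j)"
      using orthD[OF assms]
      by (auto simp: controlled_def scalar_prod_def simp flip: of_real_mult of_real_add)
  qed (auto simp: controlled_def)
qed (simp add: controlled_def)

lemma run1_controlled:
  assumes "a \<noteq> q"
  shows "run1 (Gate2 (controlled A) a q) \<psi> s =
    (if s a then \<Sum>b\<in>UNIV. complex_of_real (A (s q) b) * \<psi> (s(q := b)) else \<psi> s)"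
proof -
  have "s(a := s a) = s" "s(q := s q) = s" "s(a := s a, q := b) = s(q := b)" for b by auto
  then show ?thesis using assms
    by (cases "s a"; cases "s q"; auto simp: controlled_def UNIV_bool fun_upd_idem)
qed

lemma run1_plain:
  "run1 (Gate1 (plain A) q) \<psi> s = (\<Sum>b\<in>UNIV. complex_of_real (A (s q) b) * \<psi> (s(q := b)))"
  by (cases "s q"; auto simp: plain_def UNIV_bool)

definition swapb :: "bool \<Rightarrow> bool \<Rightarrow> real" where
  "swapb a b = of_bool (a \<noteq> b)"

lemma orth_swapb: "orth swapb"
proof -
  have "(\<Sum>r\<in>UNIV. swapb p r * swapb q r) = of_bool (p = q)" for p q
    unfolding UNIV_bool by (cases p; cases q; simp add: swapb_def)
  then show ?thesis by (simp add: orth_def)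
qed

fun gate_of :: "rgate \<Rightarrow> gate" where
  "gate_of (RX q) = Gate1 (plain swapb) q"
| "gate_of (RC a b) = Gate2 (controlled swapb) a b"
| "gate_of (RT a b c) = Toffoli a b c"

lemma gate_ok_gate_of: "rok N g \<Longrightarrow> gate_ok N (gate_of g)"
  by (cases g) (auto simp: unitary_plain unitary_controlled orth_swapb)

lemma run1_gate_of: "rok N g \<Longrightarrow> run1 (gate_of g) \<psi> s = \<psi> (ract1 g s)"
proof (cases g)
  case (RX q)
  then show ?thesis
    by (cases "s q"; simp add: run1_plain swapb_def UNIV_bool del: run1.simps)
next
  case (RC a b)
  moreover assume "rok N g"
  ultimately show ?thesis
    by (cases "s a"; cases "s b"; simp add: run1_controlled swapb_def UNIV_bool fun_upd_idem del: run1.simps)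
qed simp

text \<open>Amplitudes are pulled back: what is found at \<open>s\<close> after the circuit sat at
  the preimage of \<open>s\<close> before it, hence the reversed list.\<close>

lemma run_gate_of: "roks N gs \<Longrightarrow> run (map gate_of gs) \<psi> s = \<psi> (ract (rev gs) s)"
proof (induction gs arbitrary: \<psi> s)
  case (Cons g gs)
  then show ?case by (simp add: run1_gate_of[of N])
qed simp

lemma run_gate_of_eq: "roks N gs \<Longrightarrow> ract gs t = s \<Longrightarrow> run (map gate_of gs) \<psi> s = \<psi> t"
  by (auto simp: run_gate_of)

lemma run_rev_gate_of: "roks N gs \<Longrightarrow> run (map gate_of (rev gs)) \<psi> s = \<psi> (ract gs s)"
  using run_gate_of[of N "rev gs"] by simp

section \<open>Lattice factorization of the wavelet kernel\<close>

text \<open>An array of amplitudes with the parity as second argument, \<open>False\<close> for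
  even. Positions run over all integers, so the factorization needs no modular indices; periodic
  arrays arise later by composition with \<open>site\<close>.\<close>

type_synonym field = "int \<Rightarrow> bool \<Rightarrow> complex"

definition kernel :: "nat \<Rightarrow> (nat \<Rightarrow> real) \<Rightarrow> field \<Rightarrow> field" where
  "kernel M h y r p = (\<Sum>k<M. complex_of_real (if p then highpass M h k else h k) * y (r + int (k div 2)) (odd k))"

text \<open>The pair at \<open>r\<close> consists of the even entry at \<open>r\<close> and the odd
  entry at \<open>r + j\<close>. The selector \<open>P\<close> refers to the even partner, which is
  \<open>r - j\<close> when seen from an odd entry at \<open>r\<close>.\<close>

definition pairs :: "(bool \<Rightarrow> bool \<Rightarrow> real) \<Rightarrow> int \<Rightarrow> (int \<Rightarrow> bool) \<Rightarrow> field \<Rightarrow> field" where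
  "pairs A j P y r p =
     (if p then if P (r - j) then complex_of_real (A True False) * y (r - j) False + complex_of_real (A True True) * y r True else y r True
      else if P r then complex_of_real (A False False) * y r False + complex_of_real (A False True) * y (r + j) True else y r False)"

fun layers :: "(nat \<Rightarrow> bool \<Rightarrow> bool \<Rightarrow> real) \<Rightarrow> (nat \<Rightarrow> int \<Rightarrow> bool) \<Rightarrow> nat \<Rightarrow> field \<Rightarrow> field" where
  "layers A P 0 y = y"
| "layers A P (Suc j) y = pairs (A j) (int j) (P j) (layers A P j y)"

text \<open>Two families of pairs commute if they share no site; the hypotheses say this separately
  for even and for odd sites.\<close>

lemma pairs_commute:
  assumes "\<And>r. \<not> (P r \<and> Q r)" "\<And>r. \<not> (P (r - j) \<and> Q (r - i))"
  shows "pairs A j P (pairs B i Q y) = pairs B i Q (pairs A j P y)"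
proof (intro ext)
  fix r p
  have 1: "P r \<Longrightarrow> \<not> Q (r + j - i)" for r using assms(2)[of "r + j"] by simp
  have 2: "Q r \<Longrightarrow> \<not> P (r + i - j)" for r using assms(2)[of "r + i"] by simp
  show "pairs A j P (pairs B i Q y) r p = pairs B i Q (pairs A j P y) r p"
    using assms(1)[of r] assms(2)[of r] assms(1)[of "r - j"] assms(1)[of "r - i"] 1[of r] 2[of r]
      1[of "r - j"] 2[of "r - i"]
    by (cases p) (auto simp: pairs_def)
qed

lemma pairs_split:
  "pairs A j (\<lambda>r. \<not> P r) (pairs A j P y) = pairs A j (\<lambda>_. True) y"
  by (intro ext) (simp add: pairs_def)

definition inside :: "int \<Rightarrow> nat \<Rightarrow> int \<Rightarrow> bool" where
  "inside H j r \<longleftrightarrow> r mod H + int j < H"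

text \<open>The inside pairs of the newest layer are moved past the crossing pairs of all earlier
  layers. If two such pairs shared a site, the earlier one, having the smaller span, would fit into
  the block of the later one and would not cross.\<close>

lemma layers_split:
  assumes "H > 0"
  shows "layers A (\<lambda>_ _. True) K y = layers A (\<lambda>j r. \<not> inside H j r) K (layers A (inside H) K y)"
proof (induction K)
  case (Suc K)
  let ?out = "\<lambda>j r. \<not> inside H j r"
  have comm: "pairs (A K) (int K) (inside H K) (layers A ?out i z) =
      layers A ?out i (pairs (A K) (int K) (inside H K) z)" if "i \<le> K" for i z
    using that
  proof (induction i)
    case (Suc i)
    have 1: "\<not> (inside H K r \<and> ?out i r)" for r using Suc(2) by (auto simp: inside_def)
    \<comment> \<open>At a shared odd site \<open>r\<close> the even partner of the earlier pair
      sits at \<open>r - int i\<close>, to the right of \<open>r - int K\<close> but in the same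
      block.\<close>
    have 2: "\<not> (inside H K (r - int K) \<and> ?out i (r - int i))" for r
    proof
      assume *: "inside H K (r - int K) \<and> ?out i (r - int i)"
      let ?u = "(r - int K) mod H"
      have u: "0 \<le> ?u" "?u + int K < H" using * assms by (auto simp: inside_def)
      have "(?u + (int K - int i)) mod H = (r - int K + (int K - int i)) mod H"
        by (rule mod_add_left_eq)
      then have "(r - int i) mod H = (?u + int K - int i) mod H"
        by (simp add: add_diff_eq)
      also have "\<dots> = ?u + int K - int i" using u Suc(2) by (intro mod_pos_pos_trivial) auto
      finally show False using * u by (simp add: inside_def)
    qed
    have "pairs (A K) (int K) (inside H K) (pairs (A i) (int i) (?out i) w) =
        pairs (A i) (int i) (?out i) (pairs (A K) (int K) (inside H K) w)" for w
      by (rule pairs_commute[OF 1 2])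
    then show ?case using Suc by simp
  qed simp
  show ?case
    by (simp add: Suc pairs_split[symmetric, where P = "inside H K"] comm)
qed simp

section \<open>Orthogonality relations and peeling of the filter\<close>

definition corr :: "nat \<Rightarrow> (nat \<Rightarrow> real) \<Rightarrow> (nat \<Rightarrow> real) \<Rightarrow> nat \<Rightarrow> real" where
  "corr M a b l = (\<Sum>k<M. if k + 2 * l < M then a k * b (k + 2 * l) else 0)"

lemma corr_alt: "corr M a b l = (\<Sum>k<M - 2 * l. a k * b (k + 2 * l))"
proof -
  have "(\<Sum>k<M - 2 * l. a k * b (k + 2 * l)) = (\<Sum>k<M - 2 * l. if k + 2 * l < M then a k * b (k + 2 * l) else 0)"
    by (rule sum.cong) auto
  also have "\<dots> = corr M a b l"
    unfolding corr_def by (rule sum.mono_neutral_left) auto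
  finally show ?thesis ..
qed

lemma highpass_highpass: "even M \<Longrightarrow> k < M \<Longrightarrow> highpass M (highpass M h) k = - h k"
  by (cases "even k") (auto simp: highpass_def)

text \<open>Summing in reverse order turns a correlation of low-pass with high-pass into its own
  negative, because the alternating sign changes under \<open>k \<mapsto> ?n - 1 - k\<close> when
  \<open>?n\<close> is even.\<close>

lemma corr_highpass:
  assumes "even M"
  shows "corr M (highpass M h) (highpass M h) l = corr M h h l"
    "corr M h (highpass M h) l = 0" "corr M (highpass M h) h l = 0"
proof -
  let ?n = "M - 2 * l"
  have n: "even ?n" using assms by simp
  have re: "(\<Sum>k<?n. f k) = (\<Sum>k<?n. f (?n - Suc k))" for f :: "nat \<Rightarrow> real"
    by (rule sum.nat_diff_reindex[symmetric])
  have sgn: "(-1) ^ (?n - Suc k) = - ((-1) ^ k :: real)" if "k < ?n" for k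
    using that n by (cases "even k") (auto simp: uminus_power_if)
  show "corr M (highpass M h) (highpass M h) l = corr M h h l"
    unfolding corr_alt
    by (subst (2) re, rule sum.cong) (auto simp: highpass_def power_add power_mult uminus_power_if ac_simps)
  have "(\<Sum>k<?n. h k * highpass M h (k + 2 * l)) = (\<Sum>k<?n. - (h k * highpass M h (k + 2 * l)))"
  proof (subst re, rule sum.cong)
    fix k assume "k \<in> {..<?n}"
    then have k: "k < ?n" by simp
    then have e: "M - 1 - (?n - Suc k + 2 * l) = k" "M - 1 - (k + 2 * l) = ?n - Suc k" by auto
    show "h (?n - Suc k) * highpass M h (?n - Suc k + 2 * l) = - (h k * highpass M h (k + 2 * l))"
      unfolding highpass_def e using sgn[OF k] by (simp add: power_add power_mult)
  qed simp
  then show "corr M h (highpass M h) l = 0" unfolding corr_alt by (simp add: sum_negf)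
  have "(\<Sum>k<?n. highpass M h k * h (k + 2 * l)) = (\<Sum>k<?n. - (highpass M h k * h (k + 2 * l)))"
  proof (subst re, rule sum.cong)
    fix k assume "k \<in> {..<?n}"
    then have k: "k < ?n" by simp
    then have e: "M - 1 - (?n - Suc k) = k + 2 * l" "?n - Suc k + 2 * l = M - 1 - k" by auto
    show "highpass M h (?n - Suc k) * h (?n - Suc k + 2 * l) = - (highpass M h k * h (k + 2 * l))"
      unfolding highpass_def e using sgn[OF k] by simp
  qed simp
  then show "corr M (highpass M h) h l = 0" unfolding corr_alt by (simp add: sum_negf)
qed

lemma corr_linear:
  "corr M (\<lambda>k. c * a k + s * b k) (\<lambda>k. c * a k + s * b k) l =
    c\<^sup>2 * corr M a a l + c * s * (corr M a b l + corr M b a l) + s\<^sup>2 * corr M b b l"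
  unfolding corr_alt by (simp add: sum_distrib_left algebra_simps power2_eq_square flip: sum.distrib)

text \<open>The hypothesis makes \<open>(u, v)\<close> orthogonal to \<open>(h0, h1)\<close>, hence
  a multiple of \<open>(- h1, h0)\<close> unless the latter vanishes. This multiple is the required
  \<open>s / c\<close>; in the degenerate case a quarter turn does.\<close>

lemma peel_angle:
  fixes h0 h1 u v :: real
  assumes "h0 * u + h1 * v = 0"
  obtains c s where "c\<^sup>2 + s\<^sup>2 = 1" "c * u + s * h1 = 0" "c * v - s * h0 = 0"
proof (cases "h0 = 0 \<and> h1 = 0")
  case True
  then show ?thesis using that[of 0 1] by simp
next
  case False
  define c' s' where "c' = h0\<^sup>2 + h1\<^sup>2" and "s' = h0 * v - h1 * u"
  define R where "R = sqrt (c'\<^sup>2 + s'\<^sup>2)"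
  have "c' > 0" using False by (auto simp: c'_def sum_power2_gt_zero_iff)
  then have R: "R > 0" by (simp add: R_def add_pos_nonneg)
  have R2: "R\<^sup>2 = c'\<^sup>2 + s'\<^sup>2" by (simp add: R_def)
  have e1: "c' * u + s' * h1 = 0"
  proof -
    have "c' * u + s' * h1 = h0 * (h0 * u + h1 * v)"
      by (simp add: c'_def s'_def algebra_simps power2_eq_square)
    then show ?thesis using assms by simp
  qed
  have e2: "c' * v - s' * h0 = 0"
  proof -
    have "c' * v - s' * h0 = h1 * (h0 * u + h1 * v)"
      by (simp add: c'_def s'_def algebra_simps power2_eq_square)
    then show ?thesis using assms by simp
  qed
  show ?thesis
  proof (rule that[of "c' / R" "s' / R"])
    have "(c' / R)\<^sup>2 + (s' / R)\<^sup>2 = (c'\<^sup>2 + s'\<^sup>2) / R\<^sup>2"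
      by (simp add: power_divide add_divide_distrib)
    then show "(c' / R)\<^sup>2 + (s' / R)\<^sup>2 = 1" unfolding R2[symmetric] using R by simp
    show "c' / R * u + s' / R * h1 = 0" "c' / R * v - s' / R * h0 = 0"
      using e1 e2 R by (simp_all add: field_simps)
  qed
qed

text \<open>A suitable rotation of the low-pass against the high-pass filter kills the last two taps
  of the former and thereby the first two of its new companion, which becomes the companion of the
  shortened filter delayed by one position. Delays are not carried out but recorded: they give the
  displacement \<open>int K\<close> of the odd outputs and the distance \<open>j\<close> of the
  partners in layer \<open>j\<close>.\<close>

lemma filter_lattice:
  assumes "\<And>l. corr (2 * Suc K) h h l = of_bool (l = 0)"
  shows "\<exists>A. (\<forall>j. orth (A j)) \<and>
    (\<forall>y r p. kernel (2 * Suc K) h y r p = layers A (\<lambda>_ _. True) (Suc K) y (r + (if p then int K else 0)) p)"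
  using assms
proof (induction K arbitrary: h)
  case 0
  let ?B = "\<lambda>p q. if p then if q then - h 0 else h 1 else if q then h 1 else h 0"
  have "h 0 * h 0 + h 1 * h 1 = 1"
    using 0[of 0] by (simp add: corr_def numeral_2_eq_2)
  then have "orth ?B" by (auto simp: orth_def UNIV_bool algebra_simps)
  then show ?case
    by (intro exI[of _ "\<lambda>_. ?B"]) (auto simp: kernel_def numeral_2_eq_2 highpass_def pairs_def)
next
  case (Suc K)
  define M where "M = 2 * Suc (Suc K)"
  define N where "N = 2 * Suc K"
  have M: "M = Suc (Suc N)" "even M" "even N" by (simp_all add: M_def N_def)
  let ?g = "highpass M h"
  \<comment> \<open>At the largest shift only two products survive; their vanishing is exactly what
    the choice of the angle requires.\<close>
  have "corr M h h (Suc K) = h 0 * h N + h 1 * h (Suc N)"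
    by (simp add: corr_alt M_def N_def numeral_2_eq_2)
  then have "h 0 * h N + h 1 * h (Suc N) = 0" using Suc.prems[of "Suc K"] by (simp add: M_def)
  then obtain c s where cs: "c\<^sup>2 + s\<^sup>2 = 1" "c * h N + s * h 1 = 0" "c * h (Suc N) - s * h 0 = 0"
    by (rule peel_angle)
  define h' where "h' = (\<lambda>k. c * h k + s * ?g k)"
  let ?g' = "highpass M h'"
  have z: "h' N = 0" "h' (Suc N) = 0"
    using cs(2,3) M by (simp_all add: h'_def highpass_def)
  have g': "?g' k = c * ?g k - s * h k" if "k < M" for k
  proof -
    have "?g' k = c * ?g k + s * highpass M ?g k" by (simp add: highpass_def h'_def algebra_simps)
    then show ?thesis using highpass_highpass[OF M(2) that, of h] by simp
  qed
  have h_eq: "h k = c * h' k - s * ?g' k" "?g k = s * h' k + c * ?g' k" if "k < M" for k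
  proof -
    have "c * h' k - s * ?g' k = (c\<^sup>2 + s\<^sup>2) * h k" "s * h' k + c * ?g' k = (c\<^sup>2 + s\<^sup>2) * ?g k"
      unfolding g'[OF that] by (simp_all add: h'_def algebra_simps power2_eq_square)
    then show "h k = c * h' k - s * ?g' k" "?g k = s * h' k + c * ?g' k" using cs(1) by simp_all
  qed
  have g'_shift: "?g' 0 = 0" "?g' (Suc 0) = 0" "?g' (Suc (Suc k)) = highpass N h' k" for k
    using z M by (simp_all add: highpass_def)
  have "corr N h' h' l = of_bool (l = 0)" for l
  proof -
    \<comment> \<open>The two taps beyond \<open>N\<close> vanish, so the shortened filter has the
      correlations of the rotated one.\<close>
    have "corr N h' h' l = corr M h' h' l"
      unfolding corr_def M(1) using z M(3) by (auto intro!: sum.cong simp: less_Suc_eq)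
    also have "\<dots> = (c\<^sup>2 + s\<^sup>2) * corr M h h l"
      unfolding h'_def by (simp add: corr_linear corr_highpass[OF M(2)] algebra_simps)
    finally show ?thesis using cs(1) Suc.prems[of l] by (simp add: M_def)
  qed
  then obtain A where A: "\<And>j. orth (A j)"
    "\<And>y r p. kernel N h' y r p = layers A (\<lambda>_ _. True) (Suc K) y (r + (if p then int K else 0)) p"
    using Suc.IH[of h'] unfolding N_def by blast
  \<comment> \<open>The inverse rotation, which recovers \<open>h\<close> and its companion from
    \<open>h'\<close> and its companion, becomes the outermost layer.\<close>
  let ?B = "\<lambda>p q. if p then if q then c else s else if q then - s else c"
  let ?A = "A(Suc K := ?B)"
  have B: "orth ?B" using cs(1) by (auto simp: orth_def UNIV_bool algebra_simps power2_eq_square)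
  have same: "layers ?A (\<lambda>_ _. True) j y = layers A (\<lambda>_ _. True) j y" if "j \<le> Suc K" for j y
    using that by (induction j) auto
  have k1: "(\<Sum>k<M. complex_of_real (h' k) * y (r + int (k div 2)) (odd k)) = kernel N h' y r False" for y r
    using z by (simp add: kernel_def M(1))
  have k2: "(\<Sum>k<M. complex_of_real (?g' k) * y (r + int (k div 2)) (odd k)) = kernel N h' y (r + 1) True" for y r
    by (simp add: kernel_def M(1) sum.lessThan_Suc_shift g'_shift[unfolded M(1)] algebra_simps del: sum.lessThan_Suc)
  have K1: "kernel M h y r False = c * kernel N h' y r False - s * kernel N h' y (r + 1) True" for y r
  proof -
    have "kernel M h y r False = (\<Sum>k<M. complex_of_real (c * h' k - s * ?g' k) * y (r + int (k div 2)) (odd k))"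
      unfolding kernel_def by (rule sum.cong) (use h_eq in auto)
    also have "\<dots> = c * (\<Sum>k<M. complex_of_real (h' k) * y (r + int (k div 2)) (odd k))
        - s * (\<Sum>k<M. complex_of_real (?g' k) * y (r + int (k div 2)) (odd k))"
      by (simp add: sum_distrib_left algebra_simps flip: sum_subtractf)
    finally show ?thesis unfolding k1 k2 .
  qed
  have K2: "kernel M h y r True = s * kernel N h' y r False + c * kernel N h' y (r + 1) True" for y r
  proof -
    have "kernel M h y r True = (\<Sum>k<M. complex_of_real (s * h' k + c * ?g' k) * y (r + int (k div 2)) (odd k))"
      unfolding kernel_def by (rule sum.cong) (use h_eq in auto)
    also have "\<dots> = s * (\<Sum>k<M. complex_of_real (h' k) * y (r + int (k div 2)) (odd k))
        + c * (\<Sum>k<M. complex_of_real (?g' k) * y (r + int (k div 2)) (odd k))"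
      by (simp add: sum_distrib_left algebra_simps flip: sum.distrib)
    finally show ?thesis unfolding k1 k2 .
  qed
  have "kernel M h y r p = layers ?A (\<lambda>_ _. True) (Suc (Suc K)) y (r + (if p then int (Suc K) else 0)) p" for y r p
  proof (cases p)
    case True
    then show ?thesis using A(2)[of y r False] A(2)[of y "r + 1" True] K2[of y r]
      by (simp add: pairs_def same algebra_simps del: layers.simps add: layers.simps(2)[of _ _ "Suc K"])
  next
    case False
    then show ?thesis using A(2)[of y r False] A(2)[of y "r + 1" True] K1[of y r]
      by (simp add: pairs_def same algebra_simps del: layers.simps add: layers.simps(2)[of _ _ "Suc K"])
  qed
  moreover have "\<forall>j. orth (?A j)" using A(1) B by simp
  ultimately show ?case unfolding M_def by blast
qed

section \<open>Circuit for one level\<close>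

text \<open>Qubits: the \<open>m\<close> active data qubits consist of the parity qubit \<open>0\<close>, the position \<open>{1..<L}\<close>
  inside a block and the block number \<open>{L..<m}\<close>; \<open>n\<close> holds the flag that enables the level,
  \<open>n + 1\<close> a carry or comparison bit, and \<open>{n+2..<n+2+L}\<close> is scratch space.\<close>
locale frame =
  fixes n m L :: nat
  assumes L1: "1 \<le> L" and Lm: "L \<le> m" and mn: "m \<le> n"
begin

definition H :: int where "H = 2 ^ (L - 1)"

text \<open>Coordinates on assignments that keep the qubits from \<open>m\<close> on as they are in
  \<open>s\<close>. Only \<open>r\<close> modulo \<open>2 ^ (m - 1)\<close> matters, and this is the
  periodization.\<close>

definition site :: "asg \<Rightarrow> int \<Rightarrow> bool \<Rightarrow> asg" where
  "site s r p = reg_set (s(0 := p)) [Suc 0..<m] r"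

definition rot :: "int \<Rightarrow> int \<Rightarrow> int" where
  "rot r i = r div H * H + (r + i) mod H"

abbreviation lo where "lo \<equiv> [Suc 0..<L]"
abbreviation hi where "hi \<equiv> [L..<m]"
abbreviation clean where "clean \<equiv> low (Suc n)"

lemma H_pos: "H > 0" by (simp add: H_def)

lemma length_lo: "2 ^ length lo = H" by (simp add: H_def)

lemma rot_simps [simp]:
  "rot r i mod H = (r + i) mod H" "rot r i div H = r div H" "rot (rot r i) j = rot r (i + j)" "rot r 0 = r"
proof -
  show 1: "rot r i mod H = (r + i) mod H" for r i by (simp add: rot_def)
  show 2: "rot r i div H = r div H" for r i using H_pos by (simp add: rot_def)
  have "(rot r i + j) mod H = (rot r i mod H + j) mod H" by (simp only: mod_add_left_eq)
  also have "\<dots> = (r + (i + j)) mod H" by (simp only: 1 mod_add_left_eq add.assoc)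
  finally show "rot (rot r i) j = rot r (i + j)" unfolding rot_def[of "rot r i"] 2 by (simp add: rot_def)
  show "rot r 0 = r" by (simp add: rot_def)
qed

lemma upt_split: "[Suc 0..<m] = lo @ hi"
  using upt_add_eq_append[of "Suc 0" L "m - L"] L1 Lm by simp

lemma site_eq: "site s r p = reg_set (reg_set (s(0 := p)) hi (r div H)) lo r"
  unfolding site_def upt_split reg_set_append length_lo ..

lemma site_self: "site s (reg_val s [Suc 0..<m]) (s 0) = s"
  by (simp add: site_def)

lemma site_apply [simp]: "site s r p 0 = p" "m \<le> q \<Longrightarrow> site s r p q = s q"
  using L1 Lm by (simp_all add: site_def)

lemma site_clean [simp]: "site s r p \<in> clean \<longleftrightarrow> s \<in> clean"
  using mn by (auto simp: low_def)

lemma site_flip: "(site s r p)(0 := b) = site s r b"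
  by (simp add: site_def fun_upd_twist[of 0] flip: reg_set_upd)

lemma site_upd: "m \<le> q \<Longrightarrow> (site s r p)(q := b) = site (s(q := b)) r p"
  using L1 Lm by (simp add: site_def fun_upd_twist)

lemma reg_val_site_lo: "reg_val (site s r p) lo = r mod H"
  unfolding site_eq by (subst reg_val_reg_set) (simp_all only: distinct_upt length_lo)

lemma reg_val_site_hi: "reg_val (site s r p) hi = r div H mod 2 ^ length hi"
proof -
  have "set hi \<inter> set lo = {}" by auto
  then show ?thesis unfolding site_eq by (simp only: reg_val_reg_set_disjoint reg_val_reg_set distinct_upt)
qed

lemma site_lo: "reg_set (site s r p) lo (reg_val (site s r p) lo + \<delta>) = site s (rot r \<delta>) p"
proof -
  have "reg_set (site s r p) lo (reg_val (site s r p) lo + \<delta>) = reg_set (reg_set (s(0 := p)) hi (r div H)) lo (r mod H + \<delta>)"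
    unfolding reg_val_site_lo by (simp only: site_eq reg_set_reg_set distinct_upt)
  also have "\<dots> = reg_set (reg_set (s(0 := p)) hi (r div H)) lo (rot r \<delta>)"
    by (rule reg_set_cong_mod) (simp only: length_lo rot_simps mod_add_left_eq)
  finally show ?thesis by (simp only: site_eq rot_simps)
qed

lemma site_hi: "reg_set (site s r p) hi (reg_val (site s r p) hi + \<delta>) = site s (r + \<delta> * H) p"
proof -
  let ?s = "s(0 := p)"
  have d: "set hi \<inter> set lo = {}" "set lo \<inter> set hi = {}" by auto
  have "reg_set (site s r p) hi (reg_val (site s r p) hi + \<delta>) = reg_set (reg_set (reg_set ?s lo r) hi (r div H)) hi (reg_val (site s r p) hi + \<delta>)"
    unfolding site_eq by (simp only: reg_set_reg_set_disjoint[OF d(1)])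
  also have "\<dots> = reg_set (reg_set ?s lo r) hi (reg_val (site s r p) hi + \<delta>)" by (simp only: reg_set_reg_set distinct_upt)
  also have "\<dots> = reg_set (reg_set ?s lo r) hi ((r + \<delta> * H) div H)"
    by (rule reg_set_cong_mod) (use H_pos in \<open>simp add: reg_val_site_hi mod_add_left_eq mod_add_right_eq add.commute\<close>)
  also have "\<dots> = reg_set (reg_set ?s hi ((r + \<delta> * H) div H)) lo r" by (simp only: reg_set_reg_set_disjoint[OF d(1)])
  also have "\<dots> = reg_set (reg_set ?s hi ((r + \<delta> * H) div H)) lo (r + \<delta> * H)"
    by (rule reg_set_cong_mod) (simp only: length_lo mod_mult_self1)
  finally show ?thesis by (simp only: site_eq)
qed

lemma site_dat: "reg_set (site s r p) [Suc 0..<m] (reg_val (site s r p) [Suc 0..<m] + \<delta>) = site s (r + \<delta>) p"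
proof -
  have "reg_val (site s r p) [Suc 0..<m] = r mod 2 ^ length [Suc 0..<m]"
    unfolding site_def by (simp only: reg_val_reg_set distinct_upt)
  then have "reg_set (site s r p) [Suc 0..<m] (reg_val (site s r p) [Suc 0..<m] + \<delta>) = reg_set (s(0 := p)) [Suc 0..<m] (r mod 2 ^ length [Suc 0..<m] + \<delta>)"
    unfolding site_def by (simp only: reg_set_reg_set distinct_upt)
  also have "\<dots> = site s (r + \<delta>) p" unfolding site_def
    by (rule reg_set_cong_mod) (simp only: mod_add_left_eq)
  finally show ?thesis .
qed

text \<open>A circuit with this property is controlled by the flag: on states whose ancillas above the
  flag are clean it transforms the array of amplitudes over all sites by \<open>T\<close> if the flag is set
  and does nothing otherwise.\<close>
definition effect :: "gate list \<Rightarrow> (field \<Rightarrow> field) \<Rightarrow> bool" where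
  "effect gs T \<longleftrightarrow> (\<forall>g\<in>set gs. gate_ok (n + 2 + L) g) \<and>
    (\<forall>\<psi>. (\<forall>s. s \<notin> clean \<longrightarrow> \<psi> s = 0) \<longrightarrow>
      (\<forall>s. s \<notin> clean \<longrightarrow> run gs \<psi> s = 0) \<and>
      (\<forall>s\<in>clean. \<forall>r p. run gs \<psi> (site s r p) =
        (if s n then T (\<lambda>r p. \<psi> (site s r p)) r p else \<psi> (site s r p))))"

lemma effectI:
  assumes "\<And>g. g \<in> set gs \<Longrightarrow> gate_ok (n + 2 + L) g"
    and "\<And>\<psi> s. (\<And>s. s \<notin> clean \<Longrightarrow> \<psi> s = 0) \<Longrightarrow> s \<notin> clean \<Longrightarrow> run gs \<psi> s = 0"
    and "\<And>\<psi> s r p. (\<And>s. s \<notin> clean \<Longrightarrow> \<psi> s = 0) \<Longrightarrow> s \<in> clean \<Longrightarrow> run gs \<psi> (site s r p) =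
      (if s n then T (\<lambda>r p. \<psi> (site s r p)) r p else \<psi> (site s r p))"
  shows "effect gs T"
  unfolding effect_def
proof (intro conjI allI impI ballI)
  fix \<psi> :: "asg \<Rightarrow> complex"
  assume "\<forall>s. s \<notin> clean \<longrightarrow> \<psi> s = 0"
  then have z: "\<And>s. s \<notin> clean \<Longrightarrow> \<psi> s = 0" by blast
  show "run gs \<psi> s = 0" if "s \<notin> clean" for s by (rule assms(2)[OF z that])
  show "run gs \<psi> (site s r p) = (if s n then T (\<lambda>r p. \<psi> (site s r p)) r p else \<psi> (site s r p))"
    if "s \<in> clean" for s r p by (rule assms(3)[OF z that])
qed (rule assms(1))

lemma effectD:
  assumes "effect gs T"
  shows "g \<in> set gs \<Longrightarrow> gate_ok (n + 2 + L) g"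
    and "(\<And>s. s \<notin> clean \<Longrightarrow> \<psi> s = 0) \<Longrightarrow> s \<notin> clean \<Longrightarrow> run gs \<psi> s = 0"
    and "(\<And>s. s \<notin> clean \<Longrightarrow> \<psi> s = 0) \<Longrightarrow> s \<in> clean \<Longrightarrow> run gs \<psi> (site s r p) =
      (if s n then T (\<lambda>r p. \<psi> (site s r p)) r p else \<psi> (site s r p))"
  using assms unfolding effect_def by blast+

lemma effect_Nil: "effect [] (\<lambda>y. y)"
  by (rule effectI) simp_all

lemma effect_append:
  assumes "effect gs T" "effect hs U"
  shows "effect (gs @ hs) (\<lambda>y. U (T y))"
proof (rule effectI)
  show "gate_ok (n + 2 + L) g" if "g \<in> set (gs @ hs)" for g
    using that effectD(1)[OF assms(1)] effectD(1)[OF assms(2)] by auto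
next
  fix \<psi> :: "asg \<Rightarrow> complex"
  assume c: "\<And>s. s \<notin> clean \<Longrightarrow> \<psi> s = 0"
  have 1: "run gs \<psi> s = 0" if "s \<notin> clean" for s
    by (rule effectD(2)[OF assms(1) _ that]) (rule c)
  have 2: "run gs \<psi> (site s r p) = (if s n then T (\<lambda>r p. \<psi> (site s r p)) r p else \<psi> (site s r p))"
    if "s \<in> clean" for s r p
    by (rule effectD(3)[OF assms(1) _ that]) (rule c)
  show "run (gs @ hs) \<psi> s = 0" if "s \<notin> clean" for s
    unfolding run_simps by (rule effectD(2)[OF assms(2) _ that]) (rule 1)
  show "run (gs @ hs) \<psi> (site s r p) =
      (if s n then U (T (\<lambda>r p. \<psi> (site s r p))) r p else \<psi> (site s r p))" if s: "s \<in> clean" for s r p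
  proof -
    have "run hs (run gs \<psi>) (site s r p) =
        (if s n then U (\<lambda>r p. run gs \<psi> (site s r p)) r p else run gs \<psi> (site s r p))"
      by (rule effectD(3)[OF assms(2) _ s]) (rule 1)
    then show ?thesis by (simp add: 2[OF s])
  qed
qed

text \<open>A circuit that moves positions by \<open>f\<close> makes the amplitudes be read at the
  inverse \<open>i\<close>; its reversal makes them be read at \<open>f\<close>. Both preserve clean
  assignments, which confines the support.\<close>

lemma effect_classical:
  assumes ok: "roks (n + 2 + L) g"
    and act: "\<And>s r p. s \<in> clean \<Longrightarrow> ract g (site s r p) = (if s n then site s (f r p) p else site s r p)"
    and fi: "\<And>r p. f (i r p) p = r"
  shows "effect (map gate_of g) (\<lambda>y r p. y (i r p) p)"
    "effect (map gate_of (rev g)) (\<lambda>y r p. y (f r p) p)"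
proof -
  \<comment> \<open>Every assignment is a site of itself, so the action on sites determines the
    action on all clean assignments.\<close>
  have C: "ract g s \<in> clean" if "s \<in> clean" for s
  proof -
    have "ract g s = (if s n then site s (f (reg_val s [Suc 0..<m]) (s 0)) (s 0) else s)"
      using act[OF that, of "reg_val s [Suc 0..<m]" "s 0"] by (simp only: site_self)
    then show ?thesis using that by simp
  qed
  have C': "ract (rev g) s \<in> clean" if "s \<in> clean" for s
  proof -
    let ?r = "reg_val s [Suc 0..<m]"
    let ?t = "if s n then site s (i ?r (s 0)) (s 0) else s"
    have "ract g ?t = s"
      using act[OF that, of "i ?r (s 0)" "s 0"] act[OF that, of ?r "s 0"]
      by (cases "s n") (simp_all only: fi site_self if_True if_False)
    then have "ract (rev g) s = ?t" by (rule ract_rev_eqI[OF ok])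
    then show ?thesis using that by simp
  qed
  have okg: "\<forall>x\<in>set (map gate_of g). gate_ok (n + 2 + L) x"
    using ok by (auto simp: roks_def gate_ok_gate_of)
  show "effect (map gate_of g) (\<lambda>y r p. y (i r p) p)"
  proof (rule effectI)
    show "gate_ok (n + 2 + L) x" if "x \<in> set (map gate_of g)" for x
      using okg that by auto
  next
    fix \<psi> :: "asg \<Rightarrow> complex" and s
    assume c: "\<And>s. s \<notin> clean \<Longrightarrow> \<psi> s = 0" and s: "s \<notin> clean"
    have "ract (rev g) s \<notin> clean" using C[of "ract (rev g) s"] s unfolding ract_rev2[OF ok] by blast
    then show "run (map gate_of g) \<psi> s = 0" unfolding run_gate_of[OF ok] by (rule c)
  next
    fix \<psi> :: "asg \<Rightarrow> complex" and s r p
    assume s: "s \<in> clean"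
    show "run (map gate_of g) \<psi> (site s r p) = (if s n then \<psi> (site s (i r p) p) else \<psi> (site s r p))"
    proof (cases "s n")
      case True
      then have "ract g (site s (i r p) p) = site s r p" using act[OF s] fi by simp
      from run_gate_of_eq[OF ok this] show ?thesis using True by simp
    next
      case False
      then have "ract g (site s r p) = site s r p" using act[OF s] by simp
      from run_gate_of_eq[OF ok this] show ?thesis using False by simp
    qed
  qed
  show "effect (map gate_of (rev g)) (\<lambda>y r p. y (f r p) p)"
  proof (rule effectI)
    show "gate_ok (n + 2 + L) x" if "x \<in> set (map gate_of (rev g))" for x
      using okg that by auto
  next
    fix \<psi> :: "asg \<Rightarrow> complex" and s
    assume c: "\<And>s. s \<notin> clean \<Longrightarrow> \<psi> s = 0" and s: "s \<notin> clean"
    have "ract g s \<notin> clean" using C'[of "ract g s"] s unfolding ract_rev[OF ok] by blast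
    then show "run (map gate_of (rev g)) \<psi> s = 0" unfolding run_rev_gate_of[OF ok] by (rule c)
  next
    fix \<psi> :: "asg \<Rightarrow> complex" and s r p
    assume s: "s \<in> clean"
    show "run (map gate_of (rev g)) \<psi> (site s r p) = (if s n then \<psi> (site s (f r p) p) else \<psi> (site s r p))"
      by (simp add: run_rev_gate_of[OF ok] act[OF s])
  qed
qed

lemma n_pos: "0 < n" using L1 Lm mn by simp

lemma cleanD: "s \<in> clean \<Longrightarrow> n + 1 \<le> q \<Longrightarrow> \<not> s q"
  by (simp add: low_def)

end

section \<open>Shifts and rotations controlled by the flag\<close>

locale layout = frame +
  assumes L2: "2 \<le> L"
begin

definition scr :: "nat list" where "scr = [n + 3..<n + 2 + L]"

lemma scr_simps [simp]:
  "length scr = L - 1" "set scr = {n + 3..<n + 2 + L}" "distinct scr"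
  unfolding scr_def length_upt set_upt by (arith, simp_all only: distinct_upt)

definition control_bit :: "bool \<Rightarrow> rgate list" where
  "control_bit p = (if p then [] else [RX 0]) @ [RT n 0 (n + 2)] @ (if p then [] else [RX 0])"

definition cond_incr :: "bool \<Rightarrow> nat list \<Rightarrow> rgate list" where
  "cond_incr p reg = control_bit p @ ladder (n + 2) reg scr @ control_bit p"

text \<open>Repeated increments are affordable: in all uses \<open>k\<close> is at most
  \<open>H\<close> and \<open>reg\<close> has at most \<open>L\<close> qubits, and
  \<open>H \<le> M\<close>.\<close>

definition cond_add :: "bool \<Rightarrow> nat list \<Rightarrow> nat \<Rightarrow> rgate list" where
  "cond_add p reg k = concat (replicate k (cond_incr p reg))"

lemma ract_control_bit: "ract (control_bit p) s = s(n + 2 := (s (n + 2) \<noteq> (s n \<and> s 0 = p)))"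
  using n_pos by (auto simp: control_bit_def fun_eq_iff)

text \<open>The register avoids the qubits \<open>0\<close> and \<open>n\<close>, so repeating
  \<open>control_bit\<close> erases the control. The \<open>L - 1\<close> scratch qubits serve up to
  \<open>L\<close> bits, just enough for \<open>lo\<close> together with one carry bit.\<close>

lemma ract_cond_incr:
  assumes "\<forall>q\<ge>n + 2. \<not> s q" "distinct reg" "length reg \<le> L" "set reg \<subseteq> {1..<n + 2} - {n}"
  shows "ract (cond_incr p reg) s = reg_set s reg (reg_val s reg + of_bool (s n \<and> s 0 = p))"
proof -
  have d: "n \<notin> set reg" "0 \<notin> set reg" "n + 2 \<notin> set reg" "set reg \<inter> set scr = {}" using assms(4) by auto
  let ?b = "s n \<and> s 0 = p"
  let ?t = "s(n + 2 := ?b)"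
  have 1: "ract (control_bit p) s = ?t" using assms(1) by (simp add: ract_control_bit)
  have "ract (ladder (n + 2) reg scr) ?t = reg_set ?t reg (reg_val ?t reg + of_bool (?t (n + 2)))"
    by (rule ract_ladder) (use assms d in auto)
  also have "\<dots> = (reg_set s reg (reg_val s reg + of_bool ?b))(n + 2 := ?b)"
    using d(3) by simp
  finally have 2: "ract (ladder (n + 2) reg scr) ?t = (reg_set s reg (reg_val s reg + of_bool ?b))(n + 2 := ?b)" .
  let ?w = "reg_set s reg (reg_val s reg + of_bool ?b)"
  have w: "?w n = s n" "?w 0 = s 0" "\<not> ?w (n + 2)" using d assms(1) by simp_all
  have "ract (cond_incr p reg) s = ract (control_bit p) (?w(n + 2 := ?b))"
    unfolding cond_incr_def ract_simps 1 2 ..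
  also have "\<dots> = ?w" using w n_pos by (simp add: ract_control_bit fun_upd_idem)
  finally show ?thesis .
qed

lemma roks_cond_incr:
  assumes "distinct reg" "set reg \<subseteq> {1..<n + 2} - {n}"
  shows "roks (n + 2 + L) (cond_incr p reg)"
proof -
  have "roks (n + 2 + L) (control_bit p)" using n_pos L2 by (auto simp: control_bit_def)
  moreover have "roks (n + 2 + L) (ladder (n + 2) reg scr)"
    by (rule roks_ladder) (use assms L2 in auto)
  ultimately show ?thesis by (simp add: cond_incr_def)
qed

lemma length_cond_incr: "length (cond_incr p reg) \<le> 3 * length reg + 6"
  using length_ladder[of "n + 2" reg scr] by (simp add: cond_incr_def control_bit_def)

lemma ract_cond_add:
  assumes "\<forall>q\<ge>n + 2. \<not> s q" "distinct reg" "length reg \<le> L" "set reg \<subseteq> {1..<n + 2} - {n}"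
  shows "ract (cond_add p reg k) s = reg_set s reg (reg_val s reg + int k * of_bool (s n \<and> s 0 = p))"
  using assms(1)
proof (induction k arbitrary: s)
  case 0
  then show ?case using assms(2) by (simp add: cond_add_def)
next
  case (Suc k)
  let ?t = "reg_set s reg (reg_val s reg + of_bool (s n \<and> s 0 = p))"
  have d: "n \<notin> set reg" "0 \<notin> set reg" using assms(4) by auto
  have q: "\<forall>q\<ge>n + 2. \<not> ?t q"
  proof (intro allI impI)
    fix q assume "n + 2 \<le> q"
    moreover from this have "q \<notin> set reg" using assms(4) by auto
    ultimately show "\<not> ?t q" using Suc.prems by simp
  qed
  have "ract (cond_add p reg (Suc k)) s = ract (cond_add p reg k) ?t"
    by (simp add: cond_add_def ract_cond_incr[OF Suc.prems assms(2-4)])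
  also have "\<dots> = reg_set ?t reg (reg_val ?t reg + int k * of_bool (s n \<and> s 0 = p))"
    using Suc.IH[OF q] d by simp
  also have "\<dots> = reg_set s reg ((reg_val s reg + of_bool (s n \<and> s 0 = p)) mod 2 ^ length reg
      + int k * of_bool (s n \<and> s 0 = p))"
    by (simp only: reg_set_reg_set[OF assms(2)] reg_val_reg_set[OF assms(2)])
  also have "\<dots> = reg_set s reg (reg_val s reg + int (Suc k) * of_bool (s n \<and> s 0 = p))"
  proof (rule reg_set_cong_mod)
    have "reg_val s reg + of_bool (s n \<and> s 0 = p) + int k * of_bool (s n \<and> s 0 = p)
        = reg_val s reg + int (Suc k) * of_bool (s n \<and> s 0 = p)"
      by (simp add: algebra_simps)
    then show "((reg_val s reg + of_bool (s n \<and> s 0 = p)) mod 2 ^ length reg + int k * of_bool (s n \<and> s 0 = p))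
        mod 2 ^ length reg = (reg_val s reg + int (Suc k) * of_bool (s n \<and> s 0 = p)) mod 2 ^ length reg"
      by (simp only: mod_add_left_eq)
  qed
  finally show ?case .
qed

lemma roks_cond_add:
  assumes "distinct reg" "set reg \<subseteq> {1..<n + 2} - {n}"
  shows "roks (n + 2 + L) (cond_add p reg k)"
  using roks_cond_incr[OF assms] by (induction k) (auto simp: cond_add_def)

lemma length_cond_add: "length (cond_add p reg k) \<le> k * (3 * length reg + 6)"
proof (induction k)
  case (Suc k)
  then show ?case using length_cond_incr[of p reg] by (simp add: cond_add_def)
qed (simp add: cond_add_def)

lemma effect_cond_add:
  "effect (map gate_of (cond_add False lo k)) (\<lambda>y r p. y (if p then r else rot r (- int k)) p)"
  "effect (map gate_of (rev (cond_add False lo k))) (\<lambda>y r p. y (if p then r else rot r (int k)) p)"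
proof -
  have reg: "distinct lo" "length lo \<le> L" "set lo \<subseteq> {1..<n + 2} - {n}" using Lm mn by auto
  have act: "ract (cond_add False lo k) (site s r p) =
      (if s n then site s (if p then r else rot r (int k)) p else site s r p)" if s: "s \<in> clean" for s r p
  proof -
    have "\<not> site s r p q" if "n + 1 \<le> q" for q using s cleanD[of "site s r p" q] that by simp
    then have "ract (cond_add False lo k) (site s r p) =
        reg_set (site s r p) lo (reg_val (site s r p) lo + int k * of_bool (s n \<and> \<not> p))"
      using ract_cond_add[of "site s r p" lo False k] reg mn by simp
    then show ?thesis using site_lo[of s r p] by simp
  qed
  have fi: "(if p then (if p then r else rot r (- int k)) else rot (if p then r else rot r (- int k)) (int k)) = r" for r p
    by simp
  note * = effect_classical[OF roks_cond_add[OF reg(1,3)] act,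
      where i = "\<lambda>r p. if p then r else rot r (- int k)"]
  show "effect (map gate_of (cond_add False lo k)) (\<lambda>y r p. y (if p then r else rot r (- int k)) p)"
    "effect (map gate_of (rev (cond_add False lo k))) (\<lambda>y r p. y (if p then r else rot r (int k)) p)"
    using *[OF _ fi] by blast+
qed

text \<open>Moving by \<open>H\<close> positions is adding one to the block number, with
  \<open>n + 1\<close> as controlled increment and \<open>n + 2\<close>, \<open>n + 3\<close> as the
  clean helpers of \<open>cincr\<close>.\<close>

definition odd_block_shift :: "rgate list" where
  "odd_block_shift = [RT n 0 (n + 1)] @ cincr (n + 1) (n + 2) (n + 3) hi @ [RT n 0 (n + 1)]"

lemma hi_distinct: "distinct ((n + 1) # (n + 2) # (n + 3) # hi)"
  using mn by auto

lemma roks_cincr_hi: "roks (n + 2 + L) (cincr (n + 1) (n + 2) (n + 3) hi)"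
  by (rule roks_cincr[OF hi_distinct]) (use L2 mn in auto)

lemma effect_odd_block_shift:
  "effect (map gate_of (rev odd_block_shift)) (\<lambda>y r p. y (if p then r + H else r) p)"
proof -
  have ok: "roks (n + 2 + L) odd_block_shift" using roks_cincr_hi n_pos L2 by (simp add: odd_block_shift_def)
  have act: "ract odd_block_shift (site s r p) = (if s n then site s (if p then r + H else r) p else site s r p)"
    if s: "s \<in> clean" for s r p
  proof -
    let ?u = "site s r p" and ?b = "s n \<and> p"
    have cl: "\<not> ?u q" if "n + 1 \<le> q" for q using s cleanD[of ?u q] that by simp
    have un: "?u n = s n" using mn by simp
    let ?t = "?u(n + 1 := ?b)"
    have 1: "ract1 (RT n 0 (n + 1)) ?u = ?t" using cl[of "n + 1"] un by simp
    have "ract (cincr (n + 1) (n + 2) (n + 3) hi) ?t = reg_set ?t hi (reg_val ?t hi + of_bool (?t (n + 1)))"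
      by (rule ract_cincr[OF hi_distinct]) (use cl in auto)
    also have "\<dots> = (reg_set ?u hi (reg_val ?u hi + of_bool ?b))(n + 1 := ?b)" using mn by simp
    also have "\<dots> = (site s (r + of_bool ?b * H) p)(n + 1 := ?b)" by (simp only: site_hi)
    finally have 2: "ract (cincr (n + 1) (n + 2) (n + 3) hi) ?t = (site s (r + of_bool ?b * H) p)(n + 1 := ?b)" .
    have "ract odd_block_shift ?u = ract [RT n 0 (n + 1)] ((site s (r + of_bool ?b * H) p)(n + 1 := ?b))"
      unfolding odd_block_shift_def using 1 2 by simp
    also have "\<dots> = site s (r + of_bool ?b * H) p"
      using n_pos mn s cleanD[of s "n + 1"] by (simp add: fun_upd_idem)
    finally show ?thesis by simp
  qed
  have fi: "(if p then (if p then r - H else r) + H else (if p then r - H else r)) = r" for r p by simp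
  show ?thesis by (rule effect_classical(2)[OF ok act, where i = "\<lambda>r p. if p then r - H else r", OF _ fi])
qed

text \<open>For \<open>k \<le> H\<close> all unit increments together produce at most one carry out
  of \<open>lo\<close>. It is collected in \<open>n + 1\<close> and handed to the long register
  \<open>hi\<close> once, so the cost is of order \<open>H * L + m\<close>.\<close>

definition odd_shift :: "nat \<Rightarrow> rgate list" where
  "odd_shift k = cond_add True (lo @ [n + 1]) k @ cincr (n + 1) (n + 2) (n + 3) hi @
     rev (cond_add True (lo @ [n + 1]) k) @ cond_add True lo k"

lemma effect_odd_shift:
  assumes "int k \<le> H"
  shows "effect (map gate_of (odd_shift k)) (\<lambda>y r p. y (if p then r - int k else r) p)"
proof -
  have reg: "distinct lo" "length lo \<le> L" "set lo \<subseteq> {1..<n + 2} - {n}" using Lm mn by auto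
  have reg': "distinct (lo @ [n + 1])" "length (lo @ [n + 1]) \<le> L" "set (lo @ [n + 1]) \<subseteq> {1..<n + 2} - {n}"
    using L2 Lm mn by auto
  have ok: "roks (n + 2 + L) (odd_shift k)"
    unfolding odd_shift_def using roks_cond_add[OF reg(1,3)] roks_cond_add[OF reg'(1,3)] roks_cincr_hi by simp
  have act: "ract (odd_shift k) (site s r p) = (if s n then site s (if p then r + int k else r) p else site s r p)"
    if s: "s \<in> clean" for s r p
  proof -
    let ?u = "site s r p"
    let ?I = "\<lambda>t. (\<forall>q\<ge>n + 2. \<not> t q) \<and> t n = s n \<and> t 0 = p"
    let ?\<delta> = "int k * of_bool (s n \<and> p)"
    have cl: "\<not> ?u q" if "n + 1 \<le> q" for q using s cleanD[of ?u q] that by simp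
    have "ract (odd_shift k) ?u = reg_set ?u (lo @ hi) (reg_val ?u (lo @ hi) + ?\<delta>)"
      unfolding odd_shift_def
    proof (rule ract_carry_split[where I = ?I and c = "n + 1" and N = "n + 2 + L"])
      show "distinct (lo @ hi @ [n + 1])" using Lm mn by auto
      show "\<not> ?u (n + 1)" using cl by simp
      show "0 \<le> ?\<delta>" by simp
      show "?\<delta> \<le> 2 ^ length lo" using assms H_pos by (simp only: length_lo) (simp add: of_bool_def)
      show "roks (n + 2 + L) (cond_add True (lo @ [n + 1]) k)" by (rule roks_cond_add[OF reg'(1,3)])
      show "ract (cond_add True (lo @ [n + 1]) k) t = reg_set t (lo @ [n + 1]) (reg_val t (lo @ [n + 1]) + ?\<delta>)" if "?I t" for t
        using ract_cond_add[OF _ reg', of t True k] that by simp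
      show "ract (cincr (n + 1) (n + 2) (n + 3) hi) t = reg_set t hi (reg_val t hi + of_bool (t (n + 1)))" if "?I t" for t
        by (rule ract_cincr[OF hi_distinct]) (use that in auto)
      show "ract (cond_add True lo k) t = reg_set t lo (reg_val t lo + ?\<delta>)" if "?I t" for t
        using ract_cond_add[OF _ reg, of t True k] that by simp
      show "?I ?u" using cl mn by simp
      show "?I (reg_set t (lo @ [n + 1]) v)" if "?I t" for t v
        using that Lm mn by simp
      show "?I (reg_set t hi v)" if "?I t" for t v
        using that L2 mn by simp
    qed
    also have "\<dots> = site s (r + ?\<delta>) p" by (simp only: site_dat flip: upt_split)
    finally show ?thesis by simp
  qed
  have fi: "(if p then (if p then r - int k else r) + int k else (if p then r - int k else r)) = r" for r p by simp
  show ?thesis by (rule effect_classical(1)[OF ok act, where i = "\<lambda>r p. if p then r - int k else r", OF _ fi])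
qed

text \<open>Qubit \<open>n + 2\<close> serves twice: as the zero incoming carry of the comparison,
  and afterwards as the control formed from flag and outcome. \<open>b\<close> negates the outcome;
  \<open>True\<close> selects the inside pairs, \<open>False\<close> the crossing ones.\<close>

definition compare_gates :: "bool \<Rightarrow> nat \<Rightarrow> rgate list" where
  "compare_gates b j = cmp (n + 2) lo scr (int j) (n + 1) @ (if b then [RX (n + 1)] else []) @ [RT n (n + 1) (n + 2)]"

definition rotate :: "(bool \<Rightarrow> bool \<Rightarrow> real) \<Rightarrow> bool \<Rightarrow> nat \<Rightarrow> gate list" where
  "rotate A b j = map gate_of (compare_gates b j) @ [Gate2 (controlled A) (n + 2) 0] @ map gate_of (rev (compare_gates b j))"

lemma roks_compare_gates: "roks (n + 2 + L) (compare_gates b j)"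
proof -
  have "roks (n + 2 + L) (cmp (n + 2) lo scr (int j) (n + 1))"
    by (rule roks_cmp) (use L2 Lm mn in auto)
  then show ?thesis using L2 by (auto simp: compare_gates_def)
qed

lemma ract_compare_gates:
  assumes "s \<in> clean" "int j < H"
  shows "ract (compare_gates b j) s =
    s(n + 1 := (reg_val s lo < int j) \<noteq> b, n + 2 := s n \<and> ((reg_val s lo < int j) \<noteq> b))"
proof -
  have "ract (cmp (n + 2) lo scr (int j) (n + 1)) s =
      s(n + 1 := (s (n + 1) \<noteq> (reg_val s lo < int j + of_bool (s (n + 2)))))"
    by (rule ract_cmp) (use assms L2 Lm mn cleanD[OF assms(1)] in \<open>auto simp: H_def\<close>)
  then have c: "ract (cmp (n + 2) lo scr (int j) (n + 1)) s = s(n + 1 := reg_val s lo < int j)"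
    using cleanD[OF assms(1)] by simp
  have "\<not> s (n + 2)" using cleanD[OF assms(1)] by simp
  then show ?thesis unfolding compare_gates_def ract_simps c by (cases b) (simp_all add: fun_upd_twist)
qed

text \<open>The control depends only on the flag and the position in the block, while the rotation
  changes only the parity qubit. Uncomputing the control therefore succeeds on both branches of the
  rotation.\<close>

lemma effect_rotate:
  assumes "orth A" "int j < H"
  shows "effect (rotate A b j) (\<lambda>y r p. if (r mod H < int j) \<noteq> b
    then \<Sum>c\<in>UNIV. complex_of_real (A p c) * y r c else y r p)"
proof (rule effectI)
  show "gate_ok (n + 2 + L) g" if "g \<in> set (rotate A b j)" for g
    using that roks_compare_gates[of b j] unitary_controlled[OF assms(1)] L2
    by (auto simp: rotate_def roks_def gate_ok_gate_of)
next
  let ?P = "compare_gates b j"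
  have run: "run (rotate A b j) \<psi> s = run1 (Gate2 (controlled A) (n + 2) 0) (run (map gate_of ?P) \<psi>) (ract ?P s)" for \<psi> s
    unfolding rotate_def by (simp add: run_rev_gate_of[OF roks_compare_gates] del: run1.simps)
  have P0: "ract ?P (s(0 := c)) = (ract ?P s)(0 := c)" if "s \<in> clean" for s c
  proof -
    have "s(0 := c) \<in> clean" using that by (simp add: low_def)
    then show ?thesis using n_pos ract_compare_gates[OF _ assms(2)] that by (simp add: fun_upd_twist)
  qed
  {
    fix \<psi> :: "asg \<Rightarrow> complex" and s
    assume c: "\<And>s. s \<notin> clean \<Longrightarrow> \<psi> s = 0" and s: "s \<notin> clean"
    let ?t = "ract ?P s"
    \<comment> \<open>A nonzero amplitude would stem from a clean preimage. Changing its qubit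
      \<open>0\<close> turns it into \<open>s\<close>, and that qubit has no influence on being
      clean.\<close>
    have "run (map gate_of ?P) \<psi> (?t(0 := b')) = 0" for b'
    proof (rule ccontr)
      assume "run (map gate_of ?P) \<psi> (?t(0 := b')) \<noteq> 0"
      then have v: "ract (rev ?P) (?t(0 := b')) \<in> clean" (is "?v \<in> _")
        using c by (force simp: run_gate_of[OF roks_compare_gates])
      have "ract ?P (?v(0 := ?t 0)) = (?t(0 := b'))(0 := ?t 0)"
        using P0[OF v] ract_rev2[OF roks_compare_gates] by simp
      then have "ract ?P (?v(0 := ?t 0)) = ?t" by simp
      then have "s = ?v(0 := ?t 0)" using ract_rev[OF roks_compare_gates] by metis
      moreover have "?v(0 := ?t 0) \<in> clean" using v by (simp add: low_def)
      ultimately show False using s by metis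
    qed
    moreover from this[of "?t 0"] have "run (map gate_of ?P) \<psi> ?t = 0" by simp
    ultimately show "run (rotate A b j) \<psi> s = 0"
      unfolding run by (simp add: run1_controlled del: run1.simps)
  }
  {
    fix \<psi> :: "asg \<Rightarrow> complex" and s r p
    assume s: "s \<in> clean"
    let ?u = "site s r p"
    have u: "?u \<in> clean" using s by simp
    have lo: "reg_val ?u lo = r mod H" by (rule reg_val_site_lo)
    have 1: "run (map gate_of ?P) \<psi> ((ract ?P ?u)(0 := c)) = \<psi> (site s r c)" for c
    proof -
      have "ract ?P (site s r c) = (ract ?P ?u)(0 := c)" using P0[OF u, of c] by (simp add: site_flip)
      then show ?thesis by (rule run_gate_of_eq[OF roks_compare_gates])
    qed
    have 2: "ract ?P ?u (n + 2) \<longleftrightarrow> s n \<and> (r mod H < int j) \<noteq> b" "ract ?P ?u 0 = p"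
      using ract_compare_gates[OF u assms(2)] n_pos mn lo by auto
    have "run (rotate A b j) \<psi> ?u = (if s n \<and> (r mod H < int j) \<noteq> b
        then \<Sum>c\<in>UNIV. complex_of_real (A p c) * \<psi> (site s r c) else \<psi> ?u)"
      unfolding run using 1 1[of p] 2 by (simp add: run1_controlled fun_upd_idem del: run1.simps)
    then show "run (rotate A b j) \<psi> ?u = (if s n then if (r mod H < int j) \<noteq> b
        then \<Sum>c\<in>UNIV. complex_of_real (A p c) * \<psi> (site s r c) else \<psi> ?u else \<psi> ?u)" by simp
  }
qed

end

lemma kernel_zero: "kernel M h (\<lambda>_ _. 0) = (\<lambda>_ _. 0)"
  by (simp add: kernel_def fun_eq_iff)

section \<open>Bringing the partners of a pair together\<close>

context layout
begin

text \<open>After \<open>k\<close> rounds of the loop, the even entries have moved by \<open>k\<close> positions cyclically inside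
  their block, which puts both partners of every pair of layer \<open>k\<close> at the same position.\<close>
definition skew :: "nat \<Rightarrow> field \<Rightarrow> field" where
  "skew k y r p = y (if p then r else rot r (- int k)) p"

definition oddshift :: "int \<Rightarrow> field \<Rightarrow> field" where
  "oddshift i y r p = y (if p then r + i else r) p"

definition loop :: "(nat \<Rightarrow> bool \<Rightarrow> bool \<Rightarrow> real) \<Rightarrow> bool \<Rightarrow> nat \<Rightarrow> gate list" where
  "loop A b k = concat (map (\<lambda>j. rotate (A j) b j @ map gate_of (cond_add False lo 1)) [0..<k])"

text \<open>In skewed coordinates the even entry found at \<open>r\<close> has wrapped around its
  block exactly if \<open>r mod H < int k\<close>. Hence comparing the position with
  \<open>k\<close> tells crossing pairs from inside pairs.\<close>

lemma rot_neg:
  assumes "int k < H"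
  shows "rot r (- int k) = (if r mod H < int k then r - int k + H else r - int k)"
    and "(r - int k) mod H + int k < H \<longleftrightarrow> \<not> r mod H < int k"
proof -
  have b: "0 \<le> r mod H" "r mod H < H" using H_pos by auto
  have e: "(r - int k) mod H = (r mod H - int k) mod H" by (simp add: mod_diff_left_eq)
  have m: "(r - int k) mod H = (if r mod H < int k then r mod H - int k + H else r mod H - int k)"
  proof (cases "r mod H < int k")
    case True
    have "(r mod H - int k) mod H = (r mod H - int k + H) mod H" by simp
    also have "\<dots> = r mod H - int k + H"
      by (rule mod_pos_pos_trivial; use True b assms in linarith)
    finally show ?thesis using e True by simp
  next
    case False
    have "(r mod H - int k) mod H = r mod H - int k"
      by (rule mod_pos_pos_trivial; use False b in linarith)
    then show ?thesis using e False by simp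
  qed
  have d: "r div H * H = r - r mod H" by (simp add: minus_mod_eq_div_mult)
  show "rot r (- int k) = (if r mod H < int k then r - int k + H else r - int k)"
    unfolding rot_def using m d by simp
  show "(r - int k) mod H + int k < H \<longleftrightarrow> \<not> r mod H < int k"
    using m b by auto
qed

lemma skew_inside:
  assumes "int k < H"
  shows "(if (r mod H < int k) \<noteq> True then \<Sum>c\<in>UNIV. complex_of_real (A p c) * skew k y r c else skew k y r p) =
    skew k (pairs A (int k) (inside H k) y) r p"
  using rot_neg[OF assms, of r]
  by (cases p) (auto simp: skew_def pairs_def inside_def UNIV_bool add.commute)

text \<open>A wrapped even entry comes from \<open>r - int k + H\<close>. With the odd entries
  shifted by a block, the odd entry at the same position comes from \<open>r + H\<close>, so the two
  are again \<open>k\<close> apart, but across a block boundary.\<close>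

lemma skew_outside:
  assumes "int k < H"
  shows "(if (r mod H < int k) \<noteq> False then \<Sum>c\<in>UNIV. complex_of_real (A p c) * skew k (oddshift H y) r c
      else skew k (oddshift H y) r p) =
    skew k (oddshift H (pairs A (int k) (\<lambda>r. \<not> inside H k r) y)) r p"
proof -
  have "(r + H - int k) mod H = (r - int k) mod H" by (metis add_diff_eq diff_add_eq mod_add_self2)
  then have e: "inside H k (r + H - int k) \<longleftrightarrow> \<not> r mod H < int k" "inside H k (rot r (- int k)) \<longleftrightarrow> \<not> r mod H < int k"
    using rot_neg(2)[OF assms, of r] by (simp_all add: inside_def)
  have "rot r (- int k) + int k = r + H" "rot r (- int k) = r + H - int k" if "r mod H < int k"
    using rot_neg(1)[OF assms, of r] that by simp_all
  then show ?thesis using e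
    by (cases p) (auto simp: skew_def oddshift_def pairs_def UNIV_bool add.commute)
qed

lemma skew_Suc: "skew k y (if p then r else rot r (- int 1)) p = skew (Suc k) y r p"
  by (simp add: skew_def)

text \<open>The second loop starts from an array whose odd entries are already shifted by a block;
  conjugation with \<open>oddshift\<close> states its action in unshifted coordinates.\<close>

lemma effect_loop:
  assumes "\<And>j. orth (A j)" "int k \<le> H"
  shows "effect (loop A True k) (\<lambda>y. skew k (layers A (inside H) k y))"
    "effect (loop A False k) (\<lambda>y. skew k (oddshift H (layers A (\<lambda>j r. \<not> inside H j r) k (oddshift (- H) y))))"
proof -
  have loop_Suc: "loop A b (Suc k) = loop A b k @ rotate (A k) b k @ map gate_of (cond_add False lo 1)" for b k
    by (simp add: loop_def)
  show "effect (loop A True k) (\<lambda>y. skew k (layers A (inside H) k y))"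
    using assms(2)
  proof (induction k)
    case 0
    have "(\<lambda>y. skew 0 (layers A (inside H) 0 y)) = (\<lambda>y. y)" by (simp add: skew_def fun_eq_iff)
    then show ?case using effect_Nil by (simp add: loop_def)
  next
    case (Suc k)
    then have k: "int k < H" by simp
    from Suc have IH: "effect (loop A True k) (\<lambda>y. skew k (layers A (inside H) k y))" by simp
    note step = effect_append[OF IH effect_append[OF effect_rotate[OF assms(1) k, of k True] effect_cond_add(1)[of 1]]]
    show ?case
      unfolding loop_Suc
      by (rule back_subst[where P = "effect _", OF step])
        (simp only: skew_inside[OF k], simp only: skew_Suc layers.simps)
  qed
  show "effect (loop A False k) (\<lambda>y. skew k (oddshift H (layers A (\<lambda>j r. \<not> inside H j r) k (oddshift (- H) y))))"
    using assms(2)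
  proof (induction k)
    case 0
    have "(\<lambda>y. skew 0 (oddshift H (layers A (\<lambda>j r. \<not> inside H j r) 0 (oddshift (- H) y)))) = (\<lambda>y. y)"
      by (simp add: skew_def oddshift_def fun_eq_iff)
    then show ?case using effect_Nil by (simp add: loop_def)
  next
    case (Suc k)
    then have k: "int k < H" by simp
    from Suc have IH: "effect (loop A False k)
      (\<lambda>y. skew k (oddshift H (layers A (\<lambda>j r. \<not> inside H j r) k (oddshift (- H) y))))" by simp
    note step = effect_append[OF IH effect_append[OF effect_rotate[OF assms(1) k, of k False] effect_cond_add(1)[of 1]]]
    show ?case
      unfolding loop_Suc
      by (rule back_subst[where P = "effect _", OF step])
        (simp only: skew_outside[OF k], simp only: skew_Suc layers.simps)
  qed
qed

text \<open>Before the last shift the odd entries are read \<open>H\<close> positions ahead, whereas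
  the factorization wants them \<open>K\<close> ahead; shifting by \<open>H - K\<close> makes up the
  difference.\<close>

definition core :: "(nat \<Rightarrow> bool \<Rightarrow> bool \<Rightarrow> real) \<Rightarrow> nat \<Rightarrow> gate list" where
  "core A K = (loop A True (Suc K) @ map gate_of (rev (cond_add False lo (Suc K))) @ map gate_of (rev odd_block_shift)) @
     (loop A False (Suc K) @ map gate_of (rev (cond_add False lo (Suc K)))) @
     map gate_of (odd_shift (nat H - K))"

lemma effect_core:
  assumes "\<And>j. orth (A j)" "int (Suc K) \<le> H"
  shows "effect (core A K) (\<lambda>y r p. layers A (\<lambda>_ _. True) (Suc K) y (r + (if p then int K else 0)) p)"
proof -
  have unskew: "skew k y (if p then r else rot r (int k)) p = y r p" for k y r p
    by (simp add: skew_def)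
  have os: "y (if p then r + H else r) p = oddshift H y r p" for y :: field and r p
    by (simp add: oddshift_def)
  have oo: "oddshift (- H) (oddshift H y) = y" for y
    by (intro ext) (simp add: oddshift_def)
  have k: "int (nat H - K) = H - int K" using assms(2) by simp
  then have kH: "int (nat H - K) \<le> H" by simp
  have sh: "oddshift H y (if p then r - (H - int K) else r) p = y (r + (if p then int K else 0)) p" for y r p
    by (simp add: oddshift_def algebra_simps)
  have "effect (core A K) (\<lambda>y r p. oddshift H (layers A (\<lambda>j r. \<not> inside H j r) (Suc K) (layers A (inside H) (Suc K) y)) (if p then r - int (nat H - K) else r) p)"
    unfolding core_def
    by (rule back_subst[where P = "effect _", OF effect_append[OF effect_append[OF effect_loop(1)[OF assms]
        effect_append[OF effect_cond_add(2) effect_odd_block_shift]]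
      effect_append[OF effect_append[OF effect_loop(2)[OF assms] effect_cond_add(2)] effect_odd_shift[OF kH]]]])
      (simp only: unskew, simp only: os, simp only: oo)
  then show ?thesis
    unfolding k sh layers_split[OF H_pos, symmetric] .
qed

lemma length_rotate: "length (rotate A b j) \<le> 16 * L"
proof -
  have "length (cmp (n + 2) lo scr (int j) (n + 1)) \<le> 8 * (L - 1) + 1"
    using length_cmp[of lo scr "n + 2" "int j" "n + 1"] by simp
  then show ?thesis using L2 by (auto simp: rotate_def compare_gates_def)
qed

lemma length_loop: "length (loop A b k) \<le> k * (19 * L + 3)"
proof (induction k)
  case (Suc k)
  have "length (rotate (A k) b k) \<le> 16 * L" by (rule length_rotate)
  moreover have "length (cond_add False lo 1) \<le> 3 * L + 3"
    using length_cond_add[of False lo 1] L2 by simp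
  ultimately show ?case using Suc by (simp add: loop_def)
qed (simp add: loop_def)

text \<open>The terms stand for the two loops with the undoing of their skews, the additions inside
  blocks in the final shift, and the two increments of the block number, the only part that grows
  with \<open>m\<close>.\<close>

lemma length_core:
  assumes "int (Suc K) \<le> H"
  shows "length (core A K) \<le> Suc K * (44 * L + 12) + nat H * (9 * L + 15) + 48 * m + 2"
proof -
  have c: "length (cincr (n + 1) (n + 2) (n + 3) hi) \<le> 24 * m"
    using length_cincr[OF hi_distinct] by simp
  have s: "length (cond_add False lo (Suc K)) \<le> Suc K * (3 * L + 3)"
    using length_cond_add[of False lo "Suc K"] L2 by (simp add: algebra_simps)
  let ?k = "nat H - K"
  have "length (cond_add True (lo @ [n + 1]) ?k) \<le> nat H * (3 * L + 6)"
    using order_trans[OF length_cond_add[of True "lo @ [n + 1]" ?k] mult_le_mono1[of ?k "nat H"]] L2 by simp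
  moreover have "length (cond_add True lo ?k) \<le> nat H * (3 * L + 3)"
  proof -
    have "3 * length lo + 6 = 3 * L + 3" using L2 by simp
    then have "length (cond_add True lo ?k) \<le> ?k * (3 * L + 3)" using length_cond_add[of True lo ?k] by (simp only:)
    also have "\<dots> \<le> nat H * (3 * L + 3)" by (rule mult_le_mono1) simp
    finally show ?thesis .
  qed
  ultimately have "length (odd_shift ?k) \<le> nat H * (9 * L + 15) + 24 * m"
    using c by (simp add: odd_shift_def algebra_simps)
  moreover have "length odd_block_shift \<le> 24 * m + 2" using c by (simp add: odd_block_shift_def)
  moreover have "length (loop A b (Suc K)) \<le> Suc K * (19 * L + 3)" for b by (rule length_loop)
  from this[of True] this[of False] have "length (loop A True (Suc K)) + length (loop A False (Suc K)) \<le> Suc K * (38 * L + 6)"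
    by (simp add: algebra_simps)
  ultimately show ?thesis using s by (simp add: core_def algebra_simps)
qed

end

section \<open>Shuffle, enabling flag and the complete level\<close>

context frame
begin

fun cswap :: "nat \<Rightarrow> nat \<Rightarrow> rgate list" where
  "cswap a b = [RC b a, RT n a b, RC b a]"

text \<open>On index bits the perfect shuffle is a cyclic rotation: bit \<open>0\<close> travels to
  the top by adjacent swaps while the others move down by one.\<close>

definition shuffle_gates :: "nat \<Rightarrow> rgate list" where
  "shuffle_gates k = concat (map (\<lambda>i. cswap i (Suc i)) [0..<k])"

lemma ract_shuffle_gates:
  assumes "k < n"
  shows "ract (shuffle_gates k) s = (if s n then (\<lambda>q. if q < k then s (Suc q) else if q = k then s 0 else s q) else s)"
  using assms
proof (induction k)
  case 0
  then show ?case by (auto simp: shuffle_gates_def)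
next
  case (Suc k)
  have "ract (shuffle_gates (Suc k)) s = ract (cswap k (Suc k)) (ract (shuffle_gates k) s)"
    by (simp add: shuffle_gates_def)
  then show ?case using Suc by (auto simp: fun_eq_iff)
qed

lemma roks_shuffle_gates: "k < n \<Longrightarrow> roks (n + 2 + L) (shuffle_gates k)"
  by (induction k) (auto simp: shuffle_gates_def)

lemma length_shuffle_gates: "length (shuffle_gates k) = 3 * k"
  by (induction k) (auto simp: shuffle_gates_def)

text \<open>\<open>block_ext\<close> acts only on indices whose qubits from \<open>m\<close> to
  \<open>n - 1\<close> are zero. Negating these qubits turns the condition into a
  conjunction.\<close>

definition flag :: "rgate list" where
  "flag = map RX [m..<n] @ cand (n + 1) (n + 2) n [m..<n] @ map RX [m..<n]"

definition idle :: "asg \<Rightarrow> bool" where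
  "idle s \<longleftrightarrow> (\<forall>q\<in>{m..<n}. \<not> s q)"

lemma ract_flips: "distinct qs \<Longrightarrow> ract (map RX qs) s = (\<lambda>q. if q \<in> set qs then \<not> s q else s q)"
  by (induction qs arbitrary: s) (auto simp: fun_eq_iff)

lemma ract_flag:
  assumes "s \<in> low n"
  shows "ract flag s = s(n := idle s)"
proof -
  let ?t = "\<lambda>q. if q \<in> set [m..<n] then \<not> s q else s q"
  have z: "\<not> s q" if "n \<le> q" for q using assms that by (simp add: low_def)
  have 1: "ract (map RX [m..<n]) s = ?t" by (rule ract_flips) simp
  have 2: "ract (cand (n + 1) (n + 2) n [m..<n]) ?t = ?t(n := (\<forall>q\<in>set [m..<n]. ?t q))"
    by (rule ract_cand) (use z in auto)
  have 3: "(\<forall>q\<in>set [m..<n]. ?t q) \<longleftrightarrow> idle s" by (auto simp: idle_def)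
  have "ract flag s = ract (map RX [m..<n]) (?t(n := idle s))"
    unfolding flag_def ract_simps 1 2 3 ..
  also have "\<dots> = (\<lambda>q. if q \<in> set [m..<n] then \<not> (?t(n := idle s)) q else (?t(n := idle s)) q)"
    by (rule ract_flips) simp
  also have "\<dots> = s(n := idle s)" by (auto simp: fun_eq_iff)
  finally show ?thesis .
qed

lemma roks_flag: "roks (n + 2 + L) flag"
proof -
  have "roks (n + 2 + L) (cand (n + 1) (n + 2) n [m..<n])"
    by (rule roks_cand) (use L1 in auto)
  then show ?thesis by (auto simp: flag_def roks_def)
qed

lemma length_flag: "length flag \<le> 50 * n + 1"
  using length_cand[of "n + 1" "n + 2" n "[m..<n]"] by (simp add: flag_def)

definition level :: "gate list \<Rightarrow> gate list" where
  "level gs = map gate_of flag @ gs @ map gate_of (shuffle_gates (m - 1)) @ map gate_of (rev flag)"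

lemma level_gate_ok: "effect gs T \<Longrightarrow> g \<in> set (level gs) \<Longrightarrow> gate_ok (n + 2 + L) g"
  using effectD(1) roks_flag roks_shuffle_gates[of "m - 1"] L1 Lm mn
  by (auto simp: level_def roks_def gate_ok_gate_of)

lemma length_level: "length (level gs) \<le> length gs + 103 * n + 2"
  using length_flag length_shuffle_gates[of "m - 1"] mn by (simp add: level_def)

text \<open>The flag can be uncomputed because the level acts on the qubits below \<open>m\<close>,
  on which \<open>idle\<close> does not depend. The proof tracks that amplitudes are supported where
  the flag agrees with \<open>idle\<close>; \<open>T0\<close> ensures that no amplitude arises in a
  family of sites that had none.\<close>

lemma run_level:
  assumes T: "effect gs T" and T0: "T (\<lambda>_ _. 0) = (\<lambda>_ _. 0)"
    and \<psi>: "\<And>s. s \<notin> low n \<Longrightarrow> \<psi> s = 0"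
  shows "s \<notin> low n \<Longrightarrow> run (level gs) \<psi> s = 0"
    and "u \<in> low n \<Longrightarrow> run (level gs) \<psi> u =
      (if idle u then T (\<lambda>r p. \<psi> (site u r p)) (reg_val u [0..<m]) (u (m - 1)) else \<psi> u)"
proof -
  have m: "m - 1 < n" "m \<ge> 1" using L1 Lm mn by auto
  note ok = roks_flag roks_shuffle_gates[OF m(1)]
  define \<psi>1 where "\<psi>1 = run (map gate_of flag) \<psi>"
  define \<xi> where "\<xi> = run gs \<psi>1"
  define \<chi> where "\<chi> = run (map gate_of (shuffle_gates (m - 1))) \<xi>"
  have run: "run (level gs) \<psi> s = \<chi> (ract flag s)" for s
    unfolding level_def run_simps run_rev_gate_of[OF ok(1)] \<chi>_def \<xi>_def \<psi>1_def ..
  have \<psi>1: "\<psi>1 (u(n := idle u)) = \<psi> u" if "u \<in> low n" for u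
    unfolding \<psi>1_def by (rule run_gate_of_eq[OF ok(1) ract_flag[OF that]])
  have \<psi>1_supp: "\<exists>u\<in>low n. z = u(n := idle u)" if "\<psi>1 z \<noteq> 0" for z
  proof -
    let ?u = "ract (rev flag) z"
    have "\<psi> ?u \<noteq> 0" using that unfolding \<psi>1_def run_gate_of[OF ok(1)] .
    then have u: "?u \<in> low n" using \<psi> by blast
    moreover have "z = ?u(n := idle ?u)" using ract_flag[OF u] unfolding ract_rev2[OF ok(1)] .
    ultimately show ?thesis by blast
  qed
  have idle_upd: "idle (u(n := b)) = idle u" for u b by (simp add: idle_def)
  have idle_site: "idle (site u r p) = idle u" for u r p by (auto simp: idle_def)
  have \<psi>1_idle: "z \<in> clean" "z n = idle z" if nz: "\<psi>1 z \<noteq> 0" for z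
  proof -
    obtain u where u: "u \<in> low n" "z = u(n := idle u)" using \<psi>1_supp[OF nz] by blast
    show "z \<in> clean" using u by (auto simp: low_def)
    show "z n = idle z" unfolding u(2) idle_upd by simp
  qed
  have \<psi>1_clean: "\<psi>1 z = 0" if "z \<notin> clean" for z using \<psi>1_idle(1)[of z] that by blast
  have \<xi>: "\<xi> (site z r p) = (if z n then T (\<lambda>r p. \<psi>1 (site z r p)) r p else \<psi>1 (site z r p))"
    if "z \<in> clean" for z r p
    unfolding \<xi>_def by (rule effectD(3)[OF T _ that]) (rule \<psi>1_clean)
  have \<xi>_idle: "z \<in> clean \<and> z n = idle z" if nz: "\<xi> z \<noteq> 0" for z
  proof -
    have z: "z \<in> clean"
    proof (rule ccontr)
      assume "z \<notin> clean"
      then have "\<xi> z = 0" unfolding \<xi>_def by (intro effectD(2)[OF T]) (rule \<psi>1_clean)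
      then show False using nz by simp
    qed
    obtain r p where zs: "z = site z r p" using site_self by metis
    show ?thesis
    proof (cases "z n")
      case True
      then have "T (\<lambda>r p. \<psi>1 (site z r p)) r p \<noteq> 0" using \<xi>[OF z, of r p] nz zs by simp
      then have "(\<lambda>r p. \<psi>1 (site z r p)) \<noteq> (\<lambda>_ _. 0)" using T0 by auto
      then obtain r' p' where "\<psi>1 (site z r' p') \<noteq> 0" by blast
      from \<psi>1_idle(2)[OF this] show ?thesis using z mn by (simp add: idle_site)
    next
      case False
      then have "\<psi>1 z \<noteq> 0" using \<xi>[OF z, of r p] nz zs by simp
      from \<psi>1_idle(2)[OF this] show ?thesis using z by simp
    qed
  qed
  show "run (level gs) \<psi> s = 0" if s: "s \<notin> low n"
  proof (rule ccontr)
    assume "run (level gs) \<psi> s \<noteq> 0"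
    define x where "x = ract flag s"
    define y where "y = ract (rev (shuffle_gates (m - 1))) x"
    have "\<xi> y \<noteq> 0"
      using \<open>run (level gs) \<psi> s \<noteq> 0\<close> unfolding run \<chi>_def run_gate_of[OF ok(2)] y_def x_def .
    from \<xi>_idle[OF this] have y: "y \<in> clean" "y n = idle y" by auto
    have xy: "ract (shuffle_gates (m - 1)) y = x" unfolding y_def ract_rev2[OF ok(2)] ..
    have xq: "x q = y q" if "m \<le> q" for q
      using that m unfolding xy[symmetric] ract_shuffle_gates[OF m(1)] by auto
    have xn: "x n = idle x" using y(2) xq mn by (auto simp: idle_def)
    \<comment> \<open>The flag of \<open>x\<close> agrees with \<open>idle x\<close>, so
      \<open>x\<close> is what \<open>flag\<close> makes of \<open>u\<close>; by injectivity
      \<open>u\<close> is \<open>s\<close>.\<close>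
    define u where "u = x(n := False)"
    have "u \<in> low n" using y(1) xq mn by (auto simp: u_def low_def Suc_le_eq)
    moreover from ract_flag[OF this] have "ract flag u = x"
      unfolding u_def idle_upd xn[symmetric] fun_upd_upd fun_upd_triv .
    then have "ract (rev flag) x = u" by (rule ract_rev_eqI[OF ok(1)])
    then have "u = s" unfolding x_def ract_rev[OF ok(1)] by (rule sym)
    ultimately show False using s by simp
  qed
  show "run (level gs) \<psi> u =
      (if idle u then T (\<lambda>r p. \<psi> (site u r p)) (reg_val u [0..<m]) (u (m - 1)) else \<psi> u)" if u: "u \<in> low n"
  proof -
    let ?u = "u(n := idle u)"
    have uc: "?u \<in> clean" using u by (auto simp: low_def)
    have 1: "run (level gs) \<psi> u = \<chi> ?u" unfolding run ract_flag[OF u] ..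
    have ps: "\<psi>1 (site ?u r p) = \<psi> (site u r p)" for r p
    proof -
      have "site u r p \<in> low n" using u mn by (auto simp: low_def)
      from \<psi>1[OF this] show ?thesis using mn by (simp add: idle_site site_upd)
    qed
    show ?thesis
    proof (cases "idle u")
      case True
      \<comment> \<open>The preimage of \<open>?u\<close> under the shuffle. The top bit
        \<open>u (m - 1)\<close> becomes the parity; its presence in
        \<open>reg_val u [0..<m]\<close> is harmless because \<open>site\<close> keeps only
        \<open>m - 1\<close> bits of the position.\<close>
      let ?t = "site ?u (reg_val u [0..<m]) (u (m - 1))"
      have "ract (shuffle_gates (m - 1)) ?t = ?u"
      proof
        fix q
        have t: "?t q' = bit (reg_val u [0..<m]) (q' - 1)" if "1 \<le> q'" "q' < m" for q'
          using that by (simp add: site_def reg_set_upt)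
        show "ract (shuffle_gates (m - 1)) ?t q = ?u q"
        proof (cases "q < m - 1")
          case True
          then show ?thesis using \<open>idle u\<close> m mn t[of "Suc q"] bit_reg_val[of q m u]
            unfolding ract_shuffle_gates[OF m(1)] by simp
        next
          case False
          then show ?thesis using \<open>idle u\<close> m mn
            unfolding ract_shuffle_gates[OF m(1)] by (cases "q = m - 1") auto
        qed
      qed
      from run_gate_of_eq[OF ok(2) this] have "\<chi> ?u = \<xi> ?t" unfolding \<chi>_def .
      then show ?thesis using 1 \<xi>[OF uc] True ps by simp
    next
      case False
      have "ract (shuffle_gates (m - 1)) ?u = ?u" unfolding ract_shuffle_gates[OF m(1)] using False by simp
      from run_gate_of_eq[OF ok(2) this] have "\<chi> ?u = \<xi> ?u" unfolding \<chi>_def .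
      moreover have "\<xi> ?u = \<psi>1 ?u"
        using \<xi>[OF uc, of "reg_val ?u [Suc 0..<m]" "?u 0"] False by (simp only: site_self) simp
      ultimately show ?thesis using 1 \<psi>1[OF u] False by simp
    qed
  qed
qed

end

section \<open>Assembling the transform\<close>

lemma bit_low_iff: "bit (x::nat) \<in> low m \<longleftrightarrow> x < 2 ^ m"
proof
  assume "bit x \<in> low m"
  then obtain y :: nat where "y < 2 ^ m" "bit y = bit x"
    using bij_betw_imp_surj_on[OF bij_bits[of m]] by (metis (no_types, lifting) imageE lessThan_iff)
  then show "x < 2 ^ m" by (simp add: bit_inject)
qed (rule bit_low)

lemma reg_val_bit:
  assumes "x < 2 ^ m"
  shows "reg_val (bit (x::nat)) [0..<m] = int x"
proof -
  let ?v = "reg_val (bit x) [0..<m]"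
  have v: "0 \<le> ?v" "?v < 2 ^ m" using reg_val_bounds[of "bit x" "[0..<m]"] by auto
  have "bit (nat ?v) = (bit x :: asg)"
  proof
    fix q
    show "bit (nat ?v) q = bit x q"
    proof (cases "q < m")
      case True
      then show ?thesis using v bit_reg_val[of q m "bit x"] by (simp add: bit_nat_iff)
    next
      case False
      have "nat ?v < 2 ^ m" using v by (simp add: nat_less_iff)
      then show ?thesis using False bit_low[OF assms] bit_low[of "nat ?v" m] by (simp add: low_def)
    qed
  qed
  then have "nat ?v = x" by (simp only: bit_inject)
  then show ?thesis using v by simp
qed

text \<open>Speaks about all amplitudes with clean ancillas instead of single columns, and includes
  that the ancillas end clean; in this form circuits compose.\<close>

definition applies :: "nat \<Rightarrow> nat \<Rightarrow> gate list \<Rightarrow> complex mat \<Rightarrow> bool" where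
  "applies n a gs W \<longleftrightarrow> (\<forall>g\<in>set gs. gate_ok (n + a) g) \<and>
    (\<forall>\<psi>. (\<forall>s. s \<notin> low n \<longrightarrow> \<psi> s = 0) \<longrightarrow> (\<forall>s. s \<notin> low n \<longrightarrow> run gs \<psi> s = 0) \<and>
      (\<forall>x<2 ^ n. run gs \<psi> (bit x) = (\<Sum>c<2 ^ n. W $$ (x, c) * \<psi> (bit c))))"

lemma appliesI:
  assumes "\<And>g. g \<in> set gs \<Longrightarrow> gate_ok (n + a) g"
    and "\<And>\<psi> s. (\<And>s. s \<notin> low n \<Longrightarrow> \<psi> s = 0) \<Longrightarrow> s \<notin> low n \<Longrightarrow> run gs \<psi> s = 0"
    and "\<And>\<psi> x. (\<And>s. s \<notin> low n \<Longrightarrow> \<psi> s = 0) \<Longrightarrow> x < 2 ^ n \<Longrightarrow>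
      run gs \<psi> (bit x) = (\<Sum>c<2 ^ n. W $$ (x, c) * \<psi> (bit c))"
  shows "applies n a gs W"
  unfolding applies_def
proof (intro conjI allI impI ballI)
  fix \<psi> :: "asg \<Rightarrow> complex"
  assume "\<forall>s. s \<notin> low n \<longrightarrow> \<psi> s = 0"
  then have z: "\<And>s. s \<notin> low n \<Longrightarrow> \<psi> s = 0" by blast
  show "run gs \<psi> s = 0" if "s \<notin> low n" for s by (rule assms(2)[OF z that])
  show "run gs \<psi> (bit x) = (\<Sum>c<2 ^ n. W $$ (x, c) * \<psi> (bit c))" if "x < 2 ^ n" for x
    by (rule assms(3)[OF z that])
qed (rule assms(1))

lemma appliesD:
  assumes "applies n a gs W"
  shows "g \<in> set gs \<Longrightarrow> gate_ok (n + a) g"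
    and "(\<And>s. s \<notin> low n \<Longrightarrow> \<psi> s = 0) \<Longrightarrow> s \<notin> low n \<Longrightarrow> run gs \<psi> s = 0"
    and "(\<And>s. s \<notin> low n \<Longrightarrow> \<psi> s = 0) \<Longrightarrow> x < 2 ^ n \<Longrightarrow>
      run gs \<psi> (bit x) = (\<Sum>c<2 ^ n. W $$ (x, c) * \<psi> (bit c))"
  using assms unfolding applies_def by blast+

lemma applies_Nil: "applies n a [] (1\<^sub>m (2 ^ n))"
proof -
  have "(\<Sum>c<2 ^ n. (1\<^sub>m (2 ^ n) :: complex mat) $$ (x, c) * \<psi> (bit c)) = \<psi> (bit x)"
    if "x < 2 ^ n" for x and \<psi> :: "asg \<Rightarrow> complex"
  proof -
    have "(\<Sum>c<2 ^ n. (1\<^sub>m (2 ^ n) :: complex mat) $$ (x, c) * \<psi> (bit c)) = (\<Sum>c<2 ^ n. if c = x then \<psi> (bit c) else 0)"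
      by (rule sum.cong) (use that in auto)
    then show ?thesis using that by simp
  qed
  then show ?thesis by (simp add: applies_def)
qed

lemma applies_append:
  assumes gs: "applies n a gs W" and hs: "applies n a hs V"
    and W: "W \<in> carrier_mat (2 ^ n) (2 ^ n)" and V: "V \<in> carrier_mat (2 ^ n) (2 ^ n)"
  shows "applies n a (gs @ hs) (V * W)"
proof (rule appliesI)
  show "gate_ok (n + a) g" if "g \<in> set (gs @ hs)" for g
    using that appliesD(1)[OF gs] appliesD(1)[OF hs] by auto
next
  fix \<psi> :: "asg \<Rightarrow> complex" and s
  assume \<psi>: "\<And>s. s \<notin> low n \<Longrightarrow> \<psi> s = 0" and s: "s \<notin> low n"
  have "run gs \<psi> s = 0" if "s \<notin> low n" for s by (rule appliesD(2)[OF gs \<psi> that])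
  then show "run (gs @ hs) \<psi> s = 0" unfolding run_simps by (rule appliesD(2)[OF hs _ s])
next
  fix \<psi> :: "asg \<Rightarrow> complex" and x :: nat
  assume \<psi>: "\<And>s. s \<notin> low n \<Longrightarrow> \<psi> s = 0" and x: "x < 2 ^ n"
  have 1: "run gs \<psi> s = 0" if "s \<notin> low n" for s by (rule appliesD(2)[OF gs \<psi> that])
  have 2: "run gs \<psi> (bit c) = (\<Sum>k<2 ^ n. W $$ (c, k) * \<psi> (bit k))" if "c < 2 ^ n" for c
    by (rule appliesD(3)[OF gs \<psi> that])
  have "run (gs @ hs) \<psi> (bit x) = (\<Sum>c<2 ^ n. V $$ (x, c) * run gs \<psi> (bit c))"
    unfolding run_simps by (rule appliesD(3)[OF hs _ x]) (rule 1)
  also have "\<dots> = (\<Sum>c<2 ^ n. V $$ (x, c) * (\<Sum>k<2 ^ n. W $$ (c, k) * \<psi> (bit k)))"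
    by (rule sum.cong) (simp_all add: 2)
  also have "\<dots> = (\<Sum>c<2 ^ n. \<Sum>k<2 ^ n. V $$ (x, c) * W $$ (c, k) * \<psi> (bit k))"
    by (simp add: sum_distrib_left mult.assoc)
  also have "\<dots> = (\<Sum>k<2 ^ n. \<Sum>c<2 ^ n. V $$ (x, c) * W $$ (c, k) * \<psi> (bit k))"
    by (rule sum.swap)
  also have "\<dots> = (\<Sum>k<2 ^ n. (V * W) $$ (x, k) * \<psi> (bit k))"
  proof (rule sum.cong)
    fix k :: nat
    assume "k \<in> {..<2 ^ n}"
    then have "(V * W) $$ (x, k) = (\<Sum>c<2 ^ n. V $$ (x, c) * W $$ (c, k))"
      using W V x by (simp add: scalar_prod_def lessThan_atLeast0)
    then show "(\<Sum>c<2 ^ n. V $$ (x, c) * W $$ (c, k) * \<psi> (bit k)) = (V * W) $$ (x, k) * \<psi> (bit k)"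
      by (simp add: sum_distrib_right)
  qed simp
  finally show "run (gs @ hs) \<psi> (bit x) = (\<Sum>c<2 ^ n. (V * W) $$ (x, c) * \<psi> (bit c))" .
qed

lemma applies_implements:
  assumes "applies n a gs W"
  shows "implements_exactly n a gs W"
  unfolding implements_exactly_def
proof (intro conjI allI impI)
  show ok: "\<forall>g\<in>set gs. gate_ok (n + a) g" using appliesD(1)[OF assms] by blast
  fix r c :: nat
  assume r: "r < 2 ^ (n + a)" and c: "c < 2 ^ n"
  have c': "c < 2 ^ (n + a)" by (rule less_le_trans[OF c]) (simp add: power_increasing)
  let ?\<psi> = "\<lambda>s. of_bool (s = bit c) :: complex"
  have \<psi>: "?\<psi> s = 0" if "s \<notin> low n" for s using bit_low[OF c] that by auto
  have run: "circuit_mat (n + a) gs $$ (r, c) = run gs ?\<psi> (bit r)"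
    by (rule circuit_mat_run(2)[OF ok r c'])
  show "circuit_mat (n + a) gs $$ (r, c) = (if r < 2 ^ n then W $$ (r, c) else 0)"
  proof (cases "r < 2 ^ n")
    case True
    have "run gs ?\<psi> (bit r) = (\<Sum>k<2 ^ n. W $$ (r, k) * ?\<psi> (bit k))"
      by (rule appliesD(3)[OF assms \<psi> True])
    also have "\<dots> = (\<Sum>k<2 ^ n. if k = c then W $$ (r, k) else 0)"
      by (rule sum.cong) (simp_all add: bit_inject)
    also have "\<dots> = W $$ (r, c)" using c by simp
    finally show ?thesis using run True by simp
  next
    case False
    then have "bit r \<notin> low n" by (simp add: bit_low_iff)
    then have "run gs ?\<psi> (bit r) = 0" by (intro appliesD(2)[OF assms \<psi>])
    then show ?thesis using run False by simp
  qed
qed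

context frame
begin

lemma m_pos: "1 \<le> m" using L1 Lm by simp

lemma idle_bit:
  fixes x :: nat
  assumes "x < 2 ^ n"
  shows "idle (bit x) \<longleftrightarrow> x < 2 ^ m"
proof -
  have l: "\<not> bit x q" if "n \<le> q" for q
    using bit_low[OF assms] that unfolding low_def by blast
  show ?thesis unfolding bit_low_iff[symmetric]
  proof
    assume i: "idle (bit x)"
    have "\<not> bit x q" if "m \<le> q" for q
    proof (cases "q < n")
      case True
      then show ?thesis using i that unfolding idle_def by (meson atLeastLessThan_iff)
    next
      case False
      then show ?thesis by (intro l) simp
    qed
    then show "bit x \<in> low m" unfolding low_def by blast
  next
    assume "bit x \<in> low m"
    then have "\<not> bit x q" if "m \<le> q" for q using that unfolding low_def by blast
    then show "idle (bit x)" unfolding idle_def by (meson atLeastLessThan_iff)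
  qed
qed

text \<open>The wraparound of the periodized column index \<open>2 * x + k\<close> is the reduction
  performed by the position register.\<close>

lemma site_bit:
  assumes "x < 2 ^ m"
  shows "site (bit x) (int x + int (k div 2)) (odd k) = bit ((2 * x + k) mod 2 ^ m)"
proof
  fix q
  let ?y = "2 * x + k"
  have y: "bit (?y mod 2 ^ m) q \<longleftrightarrow> q < m \<and> bit ?y q"
    by (simp flip: take_bit_eq_mod add: bit_take_bit_iff)
  consider "q = 0" | j where "q = Suc j" "q < m" | "m \<le> q"
    by (metis not0_implies_Suc linorder_not_le)
  then show "site (bit x) (int x + int (k div 2)) (odd k) q = bit (?y mod 2 ^ m) q"
  proof cases
    case 1
    then show ?thesis unfolding y using m_pos by (simp add: bit_0)
  next
    case 2
    have "int x + int (k div 2) = int (x + k div 2)" by simp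
    then have "site (bit x) (int x + int (k div 2)) (odd k) q = bit (x + k div 2) j"
      unfolding site_def reg_set_upt using 2 by (simp only: bit_of_nat_iff_bit) simp
    moreover have "bit ?y q = bit (x + k div 2) j" using 2 by (simp add: bit_Suc)
    ultimately show ?thesis unfolding y using 2 by simp
  next
    case 3
    then show ?thesis unfolding y using bit_low[OF assms] by (simp add: low_def)
  qed
qed

lemma wavelet_level_entry:
  assumes x: "x < 2 ^ m" and c: "c < 2 ^ m"
  shows "wavelet_level M h m $$ (x, c) = complex_of_real (\<Sum>k<M. if (2 * x + k) mod 2 ^ m = c
    then if bit x (m - 1) then highpass M h k else h k else 0)"
proof -
  have m2: "(2::nat) ^ m = 2 * 2 ^ (m - 1)" using m_pos by (cases m) auto
  \<comment> \<open>The kernel row that the shuffle sends to \<open>x\<close>: even rows go to the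
    lower half, odd rows to the upper half.\<close>
  define \<sigma> where "\<sigma> = (if x < 2 ^ (m - 1) then 2 * x else 2 * (x - 2 ^ (m - 1)) + 1)"
  have \<sigma>: "\<sigma> < 2 ^ m" using x m2 by (auto simp: \<sigma>_def)
  have \<sigma>_iff: "(even k \<and> x = k div 2) \<or> (odd k \<and> x = 2 ^ (m - 1) + k div 2) \<longleftrightarrow> k = \<sigma>" if "k < 2 ^ m" for k
  proof -
    have "((even k \<and> x = k div 2) \<or> (odd k \<and> x = P + k div 2)) = (k = (if x < P then 2 * x else 2 * (x - P) + 1))"
      if "k < 2 * P" "x < 2 * P" for P
      using that by presburger
    from this[of "2 ^ (m - 1)"] show ?thesis using that x unfolding m2 \<sigma>_def by blast
  qed
  have "bit x (m - 1) \<longleftrightarrow> \<not> bit x \<in> low (m - 1)"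
  proof
    assume "bit x \<notin> low (m - 1)"
    then obtain q where q: "m - 1 \<le> q" "bit x q" by (auto simp: low_def)
    have "\<not> m \<le> q" using bit_low[OF x] q(2) unfolding low_def by blast
    then have "q = m - 1" using q(1) by simp
    then show "bit x (m - 1)" using q(2) by simp
  qed (auto simp: low_def)
  then have \<sigma>_parity: "bit x (m - 1) \<longleftrightarrow> odd \<sigma>" unfolding bit_low_iff by (simp add: \<sigma>_def)
  have "wavelet_level M h m $$ (x, c) = (\<Sum>k<2 ^ m. perfect_shuffle m $$ (x, k) * wavelet_kernel M h m $$ (k, c))"
    using x c by (simp add: wavelet_level_def perfect_shuffle_def wavelet_kernel_def scalar_prod_def lessThan_atLeast0)
  also have "\<dots> = (\<Sum>k<2 ^ m. if k = \<sigma> then wavelet_kernel M h m $$ (k, c) else 0)"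
  proof (rule sum.cong)
    fix k :: nat
    assume "k \<in> {..<2 ^ m}"
    then have k: "k < 2 ^ m" by simp
    have "perfect_shuffle m $$ (x, k) = (if k = \<sigma> then 1 else 0)"
      unfolding \<sigma>_iff[OF k, symmetric] using x k by (simp add: perfect_shuffle_def)
    then show "perfect_shuffle m $$ (x, k) * wavelet_kernel M h m $$ (k, c) = (if k = \<sigma> then wavelet_kernel M h m $$ (k, c) else 0)"
      by simp
  qed simp
  also have "\<dots> = wavelet_kernel M h m $$ (\<sigma>, c)" using \<sigma> by simp
  also have "\<dots> = complex_of_real (\<Sum>k<M. if (2 * (\<sigma> div 2) + k) mod 2 ^ m = c
      then if even \<sigma> then h k else highpass M h k else 0)"
    using \<sigma> c by (simp add: wavelet_kernel_def)
  also have "\<dots> = complex_of_real (\<Sum>k<M. if (2 * x + k) mod 2 ^ m = c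
      then if bit x (m - 1) then highpass M h k else h k else 0)"
  proof (rule arg_cong[where f = complex_of_real], rule sum.cong)
    fix k
    \<comment> \<open>In the upper half \<open>2 * (\<sigma> div 2)\<close> and \<open>2 * x\<close>
      differ by \<open>2 ^ m\<close>, so \<open>x\<close> itself may serve as the position.\<close>
    have "(2 * (\<sigma> div 2) + k) mod 2 ^ m = (2 * x + k) mod 2 ^ m"
    proof (cases "x < 2 ^ (m - 1)")
      case False
      then have "2 * x + k = 2 * (\<sigma> div 2) + k + 2 ^ m" using m2 by (simp add: \<sigma>_def)
      then show ?thesis by (simp only: mod_add_self2)
    qed (simp add: \<sigma>_def)
    then show "(if (2 * (\<sigma> div 2) + k) mod 2 ^ m = c then if even \<sigma> then h k else highpass M h k else 0) =
        (if (2 * x + k) mod 2 ^ m = c then if bit x (m - 1) then highpass M h k else h k else 0)"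
      using \<sigma>_parity by simp
  qed simp
  finally show ?thesis .
qed

lemma sum_block_ext:
  assumes x: "x < 2 ^ n"
  shows "(\<Sum>c<2 ^ n. block_ext n m (wavelet_level M h m) $$ (x, c) * \<psi> (bit c)) =
    (if idle (bit x) then kernel M h (\<lambda>r p. \<psi> (site (bit x) r p)) (reg_val (bit x) [0..<m]) (bit x (m - 1))
     else \<psi> (bit x))"
proof (cases "x < 2 ^ m")
  case True
  let ?W = "wavelet_level M h m" and ?e = "\<lambda>k. (2 * x + k) mod 2 ^ m"
  let ?a = "\<lambda>k. if bit x (m - 1) then highpass M h k else h k"
  have le: "(2::nat) ^ m \<le> 2 ^ n" using mn by simp
  have entry: "block_ext n m ?W $$ (x, c) = (if c < 2 ^ m then ?W $$ (x, c) else 0)" if "c < 2 ^ n" for c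
    using that x True by (auto simp: block_ext_def)
  have "(\<Sum>c<2 ^ n. block_ext n m ?W $$ (x, c) * \<psi> (bit c)) = (\<Sum>c<2 ^ m. block_ext n m ?W $$ (x, c) * \<psi> (bit c))"
    by (rule sum.mono_neutral_right) (use le in \<open>auto simp: entry\<close>)
  also have "\<dots> = (\<Sum>c<2 ^ m. ?W $$ (x, c) * \<psi> (bit c))"
    by (rule sum.cong) (auto simp: entry less_le_trans[OF _ le])
  also have "\<dots> = (\<Sum>c<2 ^ m. \<Sum>k<M. (if ?e k = c then complex_of_real (?a k) * \<psi> (bit c) else 0))"
  proof (rule sum.cong)
    fix c :: nat
    assume "c \<in> {..<2 ^ m}"
    then have c: "c < 2 ^ m" by simp
    show "?W $$ (x, c) * \<psi> (bit c) = (\<Sum>k<M. (if ?e k = c then complex_of_real (?a k) * \<psi> (bit c) else 0))"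
      unfolding wavelet_level_entry[OF True c] of_real_sum sum_distrib_right by (rule sum.cong) auto
  qed simp
  also have "\<dots> = (\<Sum>k<M. \<Sum>c<2 ^ m. (if ?e k = c then complex_of_real (?a k) * \<psi> (bit c) else 0))"
    by (rule sum.swap)
  also have "\<dots> = (\<Sum>k<M. complex_of_real (?a k) * \<psi> (bit (?e k)))"
    by (rule sum.cong) simp_all
  also have "\<dots> = kernel M h (\<lambda>r p. \<psi> (site (bit x) r p)) (int x) (bit x (m - 1))"
    unfolding kernel_def site_bit[OF True] ..
  finally show ?thesis using True x by (simp add: idle_bit reg_val_bit)
next
  case False
  have "(\<Sum>c<2 ^ n. block_ext n m (wavelet_level M h m) $$ (x, c) * \<psi> (bit c)) = (\<Sum>c<2 ^ n. if c = x then \<psi> (bit c) else 0)"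
    by (rule sum.cong) (use x False in \<open>auto simp: block_ext_def\<close>)
  then show ?thesis using x False by (simp add: idle_bit)
qed

lemma applies_level:
  assumes "effect gs (kernel M h)"
  shows "applies n (L + 2) (level gs) (block_ext n m (wavelet_level M h m))"
proof (rule appliesI)
  show "gate_ok (n + (L + 2)) g" if "g \<in> set (level gs)" for g
    using level_gate_ok[OF assms that] by (simp add: ac_simps)
next
  fix \<psi> :: "asg \<Rightarrow> complex"
  assume \<psi>: "\<And>s. s \<notin> low n \<Longrightarrow> \<psi> s = 0"
  show "run (level gs) \<psi> s = 0" if "s \<notin> low n" for s
    by (rule run_level(1)[OF assms kernel_zero \<psi> that])
  show "run (level gs) \<psi> (bit x) = (\<Sum>c<2 ^ n. block_ext n m (wavelet_level M h m) $$ (x, c) * \<psi> (bit c))"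
    if "x < 2 ^ n" for x
    unfolding sum_block_ext[OF that] by (rule run_level(2)[OF assms kernel_zero \<psi> bit_low[OF that]])
qed

text \<open>Serves filters of length two: there a block has a single position, and one rotation of
  the parity qubit, controlled by the flag, is the whole kernel.\<close>

lemma effect_single:
  assumes "orth A"
  shows "effect [Gate2 (controlled A) n 0] (pairs A 0 (\<lambda>_. True))"
proof (rule effectI)
  show "gate_ok (n + 2 + L) g" if "g \<in> set [Gate2 (controlled A) n 0]" for g
    using that unitary_controlled[OF assms] n_pos by simp
next
  fix \<psi> :: "asg \<Rightarrow> complex" and s
  assume \<psi>: "\<And>s. s \<notin> clean \<Longrightarrow> \<psi> s = 0" and s: "s \<notin> clean"
  have "s(0 := b) \<notin> clean" for b using s by (auto simp: low_def)
  then show "run [Gate2 (controlled A) n 0] \<psi> s = 0"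
    using \<psi> s n_pos by (simp add: run1_controlled del: run1.simps)
next
  fix \<psi> :: "asg \<Rightarrow> complex" and s r p
  show "run [Gate2 (controlled A) n 0] \<psi> (site s r p) =
    (if s n then pairs A 0 (\<lambda>_. True) (\<lambda>r p. \<psi> (site s r p)) r p else \<psi> (site s r p))"
    using n_pos mn by (simp add: run1_controlled site_flip pairs_def UNIV_bool add.commute del: run1.simps)
qed

end

section \<open>Gate counts\<close>

lemma log_bounds:
  assumes "2 \<le> M"
  defines "L \<equiv> nat \<lceil>log 2 (real M)\<rceil>"
  shows "1 \<le> L" "M \<le> 2 ^ L" "2 ^ (L - 1) \<le> M" "M \<le> 2 ^ m \<Longrightarrow> L \<le> m" "real L \<le> 4 * sqrt (real M)"
proof -
  let ?l = "log 2 (real M)"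
  have l1: "1 \<le> ?l" using assms(1) by simp
  then show L1: "1 \<le> L" unfolding L_def by linarith
  have L: "?l \<le> real L" "real L < ?l + 1" unfolding L_def using l1 by linarith+
  have M: "real M = 2 powr ?l" using assms(1) by simp
  have "real M \<le> 2 powr real L" using L(1) by (subst M) simp
  then have "real M \<le> real (2 ^ L)" by (simp add: powr_realpow)
  then show "M \<le> 2 ^ L" by linarith
  have "2 powr real (L - 1) \<le> real M" using L(2) L1 by (subst M) simp
  then have "real (2 ^ (L - 1)) \<le> real M" by (simp add: powr_realpow)
  then show "2 ^ (L - 1) \<le> M" by linarith
  show "L \<le> m" if "M \<le> 2 ^ m"
  proof -
    have "real M \<le> 2 ^ m" using that by (metis of_nat_le_iff of_nat_numeral of_nat_power)
    then have "?l \<le> log 2 (2 ^ m)" using assms(1) by (subst log_le_cancel_iff) auto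
    then have "?l \<le> real m" by simp
    then show ?thesis using L(2) by linarith
  qed
  \<comment> \<open>The inequality \<open>ln x \<le> x - 1\<close> is used at the square root of
    \<open>M\<close>, giving \<open>ln M \<le> 2 * (sqrt M - 1)\<close>, and at
    \<open>1 / 2\<close>, giving \<open>ln 2 \<ge> 1 / 2\<close>. Together they leave room for
    rounding the logarithm up.\<close>
  let ?s = "sqrt (real M)"
  have s: "?s > 0" "?s\<^sup>2 = real M" using assms(1) by simp_all
  have "ln (real M) = 2 * ln ?s" using s by (metis ln_realpow of_nat_numeral)
  also have "\<dots> \<le> 2 * (?s - 1)" using ln_le_minus_one[OF s(1)] by simp
  finally have ln: "ln (real M) \<le> 2 * (?s - 1)" .
  have "?l * ln 2 = ln (real M)" by (simp add: log_def)
  moreover have "?l * (1 / 2) \<le> ?l * ln 2"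
    using l1 ln_le_minus_one[of "1 / 2 :: real"] by (intro mult_left_mono) (auto simp: ln_div)
  ultimately have "?l \<le> 4 * ?s - 4" using ln by (simp add: algebra_simps)
  then show "real L \<le> 4 * ?s" using L(2) by linarith
qed

lemma wavelet_core:
  assumes "wavelet_filter M h" "M \<le> 2 ^ m" "m \<le> n"
  defines "L \<equiv> nat \<lceil>log 2 (real M)\<rceil>"
  shows "frame n m L" "\<exists>gs. frame.effect n m L gs (kernel M h) \<and> length gs \<le> 52 * (M * L) + 48 * n + 2"
proof -
  from assms(1) have "M > 0" "even M" and ortho:
    "\<And>l. l < M \<Longrightarrow> (\<Sum>k<M. if k + 2 * l < M then h k * h (k + 2 * l) else 0) = (if l = 0 then 1 else 0)"
    by (auto simp: wavelet_filter_def)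
  then obtain K where M: "M = 2 * Suc K" by (metis dvd_def mult_0_right not0_implies_Suc not_less_zero)
  then have M2: "2 \<le> M" by simp
  note L = log_bounds[OF M2, folded L_def]
  interpret frame n m L
    by unfold_locales (use L(1) L(4)[OF assms(2)] assms(3) in auto)
  show "frame n m L" by unfold_locales
  have "corr M h h l = of_bool (l = 0)" for l
  proof (cases "l < M")
    case True
    then show ?thesis using ortho[of l] by (simp add: corr_def)
  next
    case False
    then show ?thesis using M by (simp add: corr_def)
  qed
  then obtain A where A: "\<And>j. orth (A j)"
    "\<And>y r p. kernel M h y r p = layers A (\<lambda>_ _. True) (Suc K) y (r + (if p then int K else 0)) p"
    using filter_lattice[of K h] unfolding M by blast
  show "\<exists>gs. effect gs (kernel M h) \<and> length gs \<le> 52 * (M * L) + 48 * n + 2"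
  proof (cases K)
    case 0
    have "kernel M h = pairs (A 0) 0 (\<lambda>_. True)"
      by (intro ext) (simp add: A(2) 0)
    then show ?thesis using effect_single[OF A(1)[of 0]] by (intro exI[of _ "[Gate2 (controlled (A 0)) n 0]"]) simp
  next
    case (Suc K')
    have "L \<noteq> 1" using L(2) M Suc by auto
    then interpret layout n m L by unfold_locales (use L(1) in auto)
    have "2 * int (Suc K) \<le> int (2 ^ L)" using L(2) unfolding M by linarith
    also have "int (2 ^ L) = 2 * H" using L(1) unfolding H_def by (cases L) auto
    finally have KH: "int (Suc K) \<le> H" by simp
    have "nat H \<le> M" using L(3) unfolding H_def by (simp add: nat_power_eq)
    have "kernel M h = (\<lambda>y r p. layers A (\<lambda>_ _. True) (Suc K) y (r + (if p then int K else 0)) p)"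
      by (intro ext) (rule A(2))
    then have "effect (core A K) (kernel M h)" using effect_core[OF A(1) KH] by simp
    moreover have "length (core A K) \<le> 52 * (M * L) + 48 * n + 2"
    proof -
      have "length (core A K) \<le> Suc K * (44 * L + 12) + nat H * (9 * L + 15) + 48 * m + 2"
        by (rule length_core[OF KH])
      also have "Suc K * (44 * L + 12) = M * (22 * L + 6)" unfolding M by (simp add: algebra_simps)
      also have "nat H * (9 * L + 15) \<le> M * (9 * L + 15)" using \<open>nat H \<le> M\<close> by (rule mult_le_mono1)
      also have "M * (22 * L + 6) + M * (9 * L + 15) = M * (31 * L + 21)" by (simp add: algebra_simps)
      \<comment> \<open>Here \<open>52 = 31 + 21\<close>, by \<open>L \<ge> 1\<close>.\<close>
      also have "\<dots> \<le> M * (52 * L)" using L(1) by (intro mult_le_mono2) simp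
      finally show ?thesis using assms(3) by simp
    qed
    ultimately show ?thesis by blast
  qed
qed

lemma qwt_carrier: "qwt M h n d \<in> carrier_mat (2 ^ n) (2 ^ n)"
  by (induction d) (auto simp: block_ext_def intro!: mult_carrier_mat[of _ _ "2 ^ n"])

text \<open>The last level has the smallest register, so its size condition implies the earlier
  ones; the guard \<open>d > 0\<close> lets the induction start at the empty transform. Per level
  \<open>151 = 48 + 103\<close> and \<open>4 = 2 + 2\<close> add flag and shuffle to the
  kernel.\<close>

lemma applies_qwt:
  assumes "wavelet_filter M h" "d \<le> n" "d > 0 \<Longrightarrow> M \<le> 2 ^ (n - d + 1)"
  defines "L \<equiv> nat \<lceil>log 2 (real M)\<rceil>"
  shows "\<exists>gs. applies n (L + 2) gs (qwt M h n d) \<and> length gs \<le> d * (52 * (M * L) + 151 * n + 4)"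
  using assms(2,3)
proof (induction d)
  case 0
  then show ?case using applies_Nil by (intro exI[of _ "[]"]) simp
next
  case (Suc d)
  have e: "n - Suc d + 1 = n - d" using Suc.prems(1) by simp
  then have M: "M \<le> 2 ^ (n - d)" using Suc.prems(2) by simp
  have "M \<le> 2 ^ (n - d + 1)" using M by simp
  then obtain gs where gs: "applies n (L + 2) gs (qwt M h n d)" "length gs \<le> d * (52 * (M * L) + 151 * n + 4)"
    using Suc by auto
  note core = wavelet_core[OF assms(1) M, of n, folded L_def]
  interpret frame n "n - d" L using core(1) by simp
  obtain cs where cs: "effect cs (kernel M h)" "length cs \<le> 52 * (M * L) + 48 * n + 2"
    using core(2) by auto
  have "applies n (L + 2) (gs @ level cs) (qwt M h n (Suc d))"
    unfolding qwt.simps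
    by (rule applies_append[OF gs(1) applies_level[OF cs(1)] qwt_carrier]) (simp add: block_ext_def)
  moreover have "length (gs @ level cs) \<le> Suc d * (52 * (M * L) + 151 * n + 4)"
    using gs(2) cs(2) length_level[of cs] by simp
  ultimately show ?case by blast
qed

theorem theorem2:
  "\<exists>C::real. C > 0 \<and>
     (\<forall>M h n d. wavelet_filter M h \<longrightarrow> 0 < d \<longrightarrow> d \<le> n \<longrightarrow> M \<le> 2 ^ (n - d + 1) \<longrightarrow>
        (\<exists>gs. implements_exactly n (nat \<lceil>log 2 (real M)\<rceil> + 2) gs (qwt M h n d) \<and>
              real (length gs) \<le> C * (real d * real n + real d * real M powr (3/2))))"
proof (intro exI[of _ 220] conjI allI impI)
  fix M h n d
  assume w: "wavelet_filter M h" and d: "0 < d" "d \<le> n" and M: "M \<le> 2 ^ (n - d + 1)"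
  let ?L = "nat \<lceil>log 2 (real M)\<rceil>"
  have M2: "2 \<le> M" using w by (auto simp: wavelet_filter_def elim!: evenE)
  obtain gs where gs: "applies n (?L + 2) gs (qwt M h n d)" "length gs \<le> d * (52 * (M * ?L) + 151 * n + 4)"
    using applies_qwt[OF w d(2) M] by blast
  have n: "real n \<ge> 1" using d by simp
  have p: "real M powr (3 / 2) = real M * sqrt (real M)"
    using powr_add[of "real M" 1 "1 / 2"] M2 by (simp add: powr_half_sqrt)
  have "real M * real ?L \<le> real M * (4 * sqrt (real M))"
    using log_bounds(5)[OF M2] by (intro mult_left_mono) auto
  then have MSq: "real M * real ?L \<le> 4 * real M powr (3 / 2)" unfolding p by simp
  have "real (length gs) \<le> real (d * (52 * (M * ?L) + 151 * n + 4))" using gs(2) by (simp only: of_nat_le_iff)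
  also have "\<dots> = real d * (52 * (real M * real ?L) + 151 * real n + 4)" by simp
  also have "\<dots> \<le> real d * (220 * (real n + real M powr (3 / 2)))"
  proof (rule mult_left_mono)
    \<comment> \<open>\<open>208 = 52 * 4\<close> comes from the bound on the logarithm and
      \<open>155 = 151 + 4\<close> from \<open>n \<ge> 1\<close>; \<open>220\<close> covers
      both.\<close>
    have "52 * a + 151 * b + 4 \<le> 220 * (b + c)" if "a \<le> 4 * c" "1 \<le> b" "0 \<le> c" for a b c :: real
    proof -
      have "52 * a \<le> 208 * c" "151 * b + 4 \<le> 155 * b" using that by linarith+
      moreover have "208 * c \<le> 220 * c" "155 * b \<le> 220 * b" using that by linarith+
      ultimately show ?thesis by (simp add: distrib_left)
    qed
    from this[OF MSq n powr_ge_zero]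
    show "52 * (real M * real ?L) + 151 * real n + 4 \<le> 220 * (real n + real M powr (3 / 2))" .
  qed simp
  finally have "real (length gs) \<le> 220 * (real d * real n + real d * real M powr (3 / 2))"
    by (simp add: algebra_simps)
  then show "\<exists>gs. implements_exactly n (?L + 2) gs (qwt M h n d) \<and>
      real (length gs) \<le> 220 * (real d * real n + real d * real M powr (3/2))"
    using applies_implements[OF gs(1)] by blast
qed simp

end
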